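(* Let $M$ be a smooth manifold with a distribution $H\subseteq TM$, and let $\Phi,\Psi$ be two parabolic flows of $(M,H)$. Then the composition $(\Phi\circ\Psi)_t=\Phi_t\circ\Psi_t$ (defined on an appropriate domain) is also a parabolic flow, and the parabolic arrow $[(\Phi\circ\Psi)^m]_H$ at a point $m\in M$ only depends on the parabolic arrows $[\Phi^m]_H$ and $[\Psi^m]_H$ at the same point.
   Context: $M$ is a smooth manifold of dimension $p+q$, $H\subseteq TM$ is a distribution of rank $p$, and $N=TM/H$ has rank $q$. An $H$-coordinate chart at $m\in M$ is a coordinate chart $\phi:U\to\mathbb{R}^{p+q}$ on an open set $U\ni m$ with $\phi(m)=0$ such that the first $p$ coordinate vectors at $m$ span $H_m$. Two smooth curves $c_1,c_2$ in $M$, defined near $t=0$ and tangent to $H$ at $t=0$, satisfy $c_1\sim_Hc_2$ if $c_1(0)=c_2(0)$ and, in $H$-coordinates centered at that point, $c_1'(0)=c_2'(0)$ and $c_1''(0)-c_2''(0)\in\mathbb{R}^p\times\{0\}$. This does not depend on the choice of $H$-coordinates. An equivalence class $[c]_H$ is called a parabolic arrow at $c(0)$; $T_HM_m$ is the set of parabolic arrows at $m$. A local flow of $M$ is a smooth map $\Phi:V\to M$, $V\subseteq M\times\mathbb{R}$ open, written $\Phi_t(m)=\Phi(m,t)$, such that $\Phi_0(m)=m$ and each $\Phi_t$ is a local diffeomorphism where defined (no one-parameter group property is required). Flows compose by $(\Phi\circ\Psi)(m,t)=\Phi(\Psi(m,t),t)$ wherever this is defined. A parabolic flow of $(M,H)$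 is a local flow $\Phi:V\to M$ whose generating vector field at $t=0$, $m\mapsto\frac{\partial\Phi}{\partial t}(m,0)$ (defined at points $m$ with $(m,0)\in V$), is a section of $H$. For a parabolic flow, each flow line $\Phi^m(t)=\Phi(m,t)$ is tangent to $H$ at $t=0$ and so determines a parabolic arrow $[\Phi^m]_H\in T_HM_m$ (for $(m,0)\in V$). *)

theory Defs
  imports "HOL-Analysis.Analysis" "HOL-Library.Function_Algebras"
begin

subsection \<open>Smooth maps between open subsets of Euclidean spaces\<close>

text \<open>On open sets in finite dimension, having directional derivatives of class $C^k$ in all
  directions is the same as having partial derivatives of class $C^k$.\<close>

primrec Ck_on :: "nat \<Rightarrow> ('a::real_normed_vector \<Rightarrow> 'b::real_normed_vector) \<Rightarrow> 'a set \<Rightarrow> bool" where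
  "Ck_on 0 f S \<longleftrightarrow> continuous_on S f"
| "Ck_on (Suc k) f S \<longleftrightarrow>
     (\<forall>x\<in>S. f differentiable (at x)) \<and>
     (\<forall>v. Ck_on k (\<lambda>x. frechet_derivative f (at x) v) S)"

definition smooth_on :: "('a::real_normed_vector \<Rightarrow> 'b::real_normed_vector) \<Rightarrow> 'a set \<Rightarrow> bool" where
  "smooth_on f S \<longleftrightarrow> (\<forall>k. Ck_on k f S)"

subsection \<open>Smooth manifolds\<close>

text \<open>A chart is its domain together with a total function whose values outside the domain are
  irrelevant. The manifold is the whole type of points; its smooth structure is the one
  generated by an atlas.\<close>

type_synonym ('m, 'e) chart = "'m set \<times> ('m \<Rightarrow> 'e)"

definition topological_chart :: "('m::topological_space, 'e::euclidean_space) chart \<Rightarrow> bool" where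
  "topological_chart = (\<lambda>(U, \<phi>). open U \<and> open (\<phi> ` U) \<and>
     homeomorphism U (\<phi> ` U) \<phi> (inv_into U \<phi>))"

definition compatible ::
    "('m::topological_space, 'e::euclidean_space) chart \<Rightarrow> ('m, 'e) chart \<Rightarrow> bool" where
  "compatible = (\<lambda>(U, \<phi>) (W, \<psi>).
     smooth_on (\<lambda>x. \<psi> (inv_into U \<phi> x)) (\<phi> ` (U \<inter> W)) \<and>
     smooth_on (\<lambda>x. \<phi> (inv_into W \<psi> x)) (\<psi> ` (U \<inter> W)))"

definition smooth_atlas ::
    "('m::{t2_space,second_countable_topology}, 'e::euclidean_space) chart set \<Rightarrow> bool" where
  "smooth_atlas A \<longleftrightarrow>
     (\<forall>\<kappa>\<in>A. topological_chart \<kappa>) \<and> (\<forall>\<kappa>\<in>A. \<forall>\<kappa>'\<in>A. compatible \<kappa> \<kappa>') \<and> (\<Union>\<kappa>\<in>A. fst \<kappa>) = UNIV"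

text \<open>The charts of the maximal atlas containing \<open>A\<close>.\<close>

definition coordinate_chart ::
    "('m::topological_space, 'e::euclidean_space) chart set \<Rightarrow> ('m, 'e) chart \<Rightarrow> bool" where
  "coordinate_chart A \<kappa> \<longleftrightarrow> topological_chart \<kappa> \<and> (\<forall>\<kappa>'\<in>A. compatible \<kappa> \<kappa>')"

definition euclidean_atlas :: "('e::euclidean_space, 'e) chart set" where
  "euclidean_atlas = {(UNIV, \<lambda>x. x)}"

definition prod_atlas ::
    "('m, 'e) chart set \<Rightarrow> ('n, 'f) chart set \<Rightarrow> ('m \<times> 'n, 'e \<times> 'f) chart set" where
  "prod_atlas A B = {(U \<times> W, map_prod \<phi> \<psi>) |U \<phi> W \<psi>. (U, \<phi>) \<in> A \<and> (W, \<psi>) \<in> B}"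

text \<open>To be used with an open set \<open>S\<close> only; continuity then makes the sets on which the local
  representatives are required to be smooth open.\<close>

definition smooth_map ::
    "('m::topological_space, 'e::euclidean_space) chart set \<Rightarrow>
     ('n::topological_space, 'f::euclidean_space) chart set \<Rightarrow> ('m \<Rightarrow> 'n) \<Rightarrow> 'm set \<Rightarrow> bool" where
  "smooth_map A B f S \<longleftrightarrow> continuous_on S f \<and>
     (\<forall>(U, \<phi>)\<in>A. \<forall>(W, \<psi>)\<in>B.
        smooth_on (\<lambda>x. \<psi> (f (inv_into U \<phi> x))) (\<phi> ` (U \<inter> S \<inter> f -` W)))"

definition local_diffeo ::
    "('m::topological_space, 'e::euclidean_space) chart set \<Rightarrow> ('m \<Rightarrow> 'm) \<Rightarrow> 'm set \<Rightarrow> bool" where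
  "local_diffeo A f S \<longleftrightarrow>
     (\<forall>m\<in>S. \<exists>U. open U \<and> m \<in> U \<and> U \<subseteq> S \<and> inj_on f U \<and> open (f ` U) \<and>
        smooth_map A A f U \<and> smooth_map A A (inv_into U f) (f ` U))"

subsection \<open>Curves and tangent vectors\<close>

text \<open>A curve defined near \<open>0\<close> is a total function, of which only the germ at \<open>0\<close> matters.\<close>

definition smooth_curve ::
    "('m::topological_space, 'e::euclidean_space) chart set \<Rightarrow> (real \<Rightarrow> 'm) \<Rightarrow> bool" where
  "smooth_curve A c \<longleftrightarrow> (\<exists>\<epsilon>>0. smooth_map euclidean_atlas A c {-\<epsilon><..<\<epsilon>})"

text \<open>A tangent vector at \<open>m\<close> acts as a derivation on the real functions that are smooth near
  \<open>m\<close>, and is given the value \<open>0\<close> on all other functions. Tangent vectors are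
  added and scaled pointwise; the library supplies only the additive structure on functions.\<close>

type_synonym 'm tangent = "('m \<Rightarrow> real) \<Rightarrow> real"

instantiation "fun" :: (type, real_vector) real_vector
begin

definition scaleR_fun :: "real \<Rightarrow> ('a \<Rightarrow> 'b) \<Rightarrow> 'a \<Rightarrow> 'b" where
  "scaleR_fun r f = (\<lambda>x. r *\<^sub>R f x)"

instance
  by standard (auto simp: scaleR_fun_def plus_fun_def algebra_simps)

end

definition smooth_near ::
    "('m::topological_space, 'e::euclidean_space) chart set \<Rightarrow> 'm \<Rightarrow> ('m \<Rightarrow> real) \<Rightarrow> bool" where
  "smooth_near A m f \<longleftrightarrow> (\<exists>U. open U \<and> m \<in> U \<and> smooth_map A euclidean_atlas f U)"

definition velocity ::
    "('m::topological_space, 'e::euclidean_space) chart set \<Rightarrow> (real \<Rightarrow> 'm) \<Rightarrow> 'm tangent" where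
  "velocity A c = (\<lambda>f. if smooth_near A (c 0) f then deriv (\<lambda>t. f (c t)) 0 else 0)"

definition tangent_space ::
    "('m::topological_space, 'e::euclidean_space) chart set \<Rightarrow> 'm \<Rightarrow> 'm tangent set" where
  "tangent_space A m = {velocity A c |c. smooth_curve A c \<and> c 0 = m}"

definition smooth_vector_field ::
    "('m::topological_space, 'e::euclidean_space) chart set \<Rightarrow> ('m \<Rightarrow> 'm tangent) \<Rightarrow> 'm set \<Rightarrow> bool" where
  "smooth_vector_field A X U \<longleftrightarrow> (\<forall>x\<in>U. X x \<in> tangent_space A x) \<and>
     (\<forall>W f. open W \<longrightarrow> W \<subseteq> U \<longrightarrow> smooth_map A euclidean_atlas f W \<longrightarrow>
        smooth_map A euclidean_atlas (\<lambda>x. X x f) W)"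

definition coordinate_vector ::
    "('m::topological_space, (real, 'n::finite) vec) chart set \<Rightarrow> ('m, (real, 'n) vec) chart \<Rightarrow> 'm \<Rightarrow> 'n \<Rightarrow> 'm tangent" where
  "coordinate_vector A = (\<lambda>(U, \<phi>) m i.
     velocity A (\<lambda>t. inv_into U \<phi> (\<phi> m + t *\<^sub>R axis i 1)))"

subsection \<open>Distributions and \<open>H\<close>-coordinates\<close>

text \<open>A distribution of rank \<open>p\<close> is a smooth subbundle \<open>H\<close> of the tangent bundle, given by its
  fibres: it has smooth local frames of \<open>p\<close> vector fields.\<close>

definition distribution ::
    "('m::topological_space, 'e::euclidean_space) chart set \<Rightarrow> nat \<Rightarrow> ('m \<Rightarrow> 'm tangent set) \<Rightarrow> bool" where
  "distribution A p H \<longleftrightarrow>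
     (\<forall>m. H m \<subseteq> tangent_space A m \<and> subspace (H m) \<and> dim (H m) = p) \<and>
     (\<forall>m. \<exists>U X. open U \<and> m \<in> U \<and> (\<forall>i<p. smooth_vector_field A (X i) U) \<and>
        (\<forall>x\<in>U. H x = span {X i x |i. i < (p::nat)}))"

text \<open>The coordinates are indexed by a linearly ordered type; these are the first \<open>p\<close> indices
  (all of them if there are fewer).\<close>

definition first_indices :: "nat \<Rightarrow> 'n::{finite,linorder} set" where
  "first_indices p = {i. card {j. j < i} < p}"

definition H_chart ::
    "('m::topological_space, (real, 'n::{finite,linorder}) vec) chart set \<Rightarrow> nat \<Rightarrow> ('m \<Rightarrow> 'm tangent set) \<Rightarrow>
     'm \<Rightarrow> ('m, (real, 'n) vec) chart \<Rightarrow> bool" where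
  "H_chart A p H m = (\<lambda>(U, \<phi>). coordinate_chart A (U, \<phi>) \<and> m \<in> U \<and> \<phi> m = 0 \<and>
     span (coordinate_vector A (U, \<phi>) m ` first_indices p) = H m)"

subsection \<open>Parabolic arrows\<close>

definition parabolic_curve ::
    "('m::topological_space, 'e::euclidean_space) chart set \<Rightarrow> ('m \<Rightarrow> 'm tangent set) \<Rightarrow> (real \<Rightarrow> 'm) \<Rightarrow> bool" where
  "parabolic_curve A H c \<longleftrightarrow> smooth_curve A c \<and> velocity A c \<in> H (c 0)"

text \<open>The coordinate condition does not depend on the choice of \<open>H\<close>-coordinates, which exist
  at every point when \<open>H\<close> is a distribution.\<close>

definition parabolic_equiv ::
    "('m::topological_space, (real, 'n::{finite,linorder}) vec) chart set \<Rightarrow> nat \<Rightarrow> ('m \<Rightarrow> 'm tangent set) \<Rightarrow>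
     (real \<Rightarrow> 'm) \<Rightarrow> (real \<Rightarrow> 'm) \<Rightarrow> bool" where
  "parabolic_equiv A p H c\<^sub>1 c\<^sub>2 \<longleftrightarrow>
     parabolic_curve A H c\<^sub>1 \<and> parabolic_curve A H c\<^sub>2 \<and> c\<^sub>1 0 = c\<^sub>2 0 \<and>
     (\<forall>U \<phi>. H_chart A p H (c\<^sub>1 0) (U, \<phi>) \<longrightarrow>
        (let x\<^sub>1 = (\<lambda>t. \<phi> (c\<^sub>1 t)); x\<^sub>2 = (\<lambda>t. \<phi> (c\<^sub>2 t));
             d = (\<lambda>x t. vector_derivative x (at t)) in
         d x\<^sub>1 0 = d x\<^sub>2 0 \<and>
         (\<forall>i. i \<notin> first_indices p \<longrightarrow> (d (d x\<^sub>1) 0 - d (d x\<^sub>2) 0) $ i = 0)))"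

definition parabolic_arrow ::
    "('m::topological_space, (real, 'n::{finite,linorder}) vec) chart set \<Rightarrow> nat \<Rightarrow> ('m \<Rightarrow> 'm tangent set) \<Rightarrow>
     (real \<Rightarrow> 'm) \<Rightarrow> (real \<Rightarrow> 'm) set" where
  "parabolic_arrow A p H c = {c'. parabolic_equiv A p H c c'}"

subsection \<open>Parabolic flows\<close>

definition local_flow ::
    "('m::topological_space, 'e::euclidean_space) chart set \<Rightarrow> ('m \<times> real) set \<Rightarrow> ('m \<times> real \<Rightarrow> 'm) \<Rightarrow> bool" where
  "local_flow A V \<Phi> \<longleftrightarrow> open V \<and> smooth_map (prod_atlas A euclidean_atlas) A \<Phi> V \<and>
     (\<forall>m. (m, 0) \<in> V \<longrightarrow> \<Phi> (m, 0) = m) \<and>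
     (\<forall>t. local_diffeo A (\<lambda>m. \<Phi> (m, t)) {m. (m, t) \<in> V})"

definition flow_line :: "('m \<times> real \<Rightarrow> 'm) \<Rightarrow> 'm \<Rightarrow> real \<Rightarrow> 'm" where
  "flow_line \<Phi> m = (\<lambda>t. \<Phi> (m, t))"

definition parabolic_flow ::
    "('m::topological_space, 'e::euclidean_space) chart set \<Rightarrow> ('m \<Rightarrow> 'm tangent set) \<Rightarrow>
     ('m \<times> real) set \<Rightarrow> ('m \<times> real \<Rightarrow> 'm) \<Rightarrow> bool" where
  "parabolic_flow A H V \<Phi> \<longleftrightarrow> local_flow A V \<Phi> \<and>
     (\<forall>m. (m, 0) \<in> V \<longrightarrow> velocity A (flow_line \<Phi> m) \<in> H m)"

definition flow_comp :: "('m \<times> real \<Rightarrow> 'm) \<Rightarrow> ('m \<times> real \<Rightarrow> 'm) \<Rightarrow> 'm \<times> real \<Rightarrow> 'm" where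
  "flow_comp \<Phi> \<Psi> = (\<lambda>(m, t). \<Phi> (\<Psi> (m, t), t))"

definition flow_comp_dom :: "('m \<times> real) set \<Rightarrow> ('m \<times> real) set \<Rightarrow> ('m \<times> real \<Rightarrow> 'm) \<Rightarrow> ('m \<times> real) set" where
  "flow_comp_dom V W \<Psi> = {(m, t). (m, t) \<in> W \<and> (\<Psi> (m, t), t) \<in> V}"

end

theory Submission
  imports Defs
begin

text \<open>Fix $H$-coordinates \<open>\<phi>\<close> at a point \<open>m\<close> and let $x_0 = \phi(m)$. Write a parabolic flow \<open>\<Phi>\<close> in these
  coordinates as $F(x,t)$, let $g(t)$ be the flow line of \<open>\<Psi>\<close> starting at \<open>m\<close>, and let $v$ be its
  velocity at $t=0$. Then the flow line of the composition is $F(g(t),t)$, where $F(x,0)=x$.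

  The chain rule for derivations gives its velocity at $t=0$ as the sum of the velocities of \<open>\<Psi>\<close> and
  \<open>\<Phi>\<close> (\<open>velocity_flow_comp\<close>). Since $H_m$ is a subspace, the composition is parabolic.

  For the second-order part, expand formally
  \[ F(g(t),t) = g(t) + t\,X(g(t)) + \frac{t^2}{2}\,\partial_t^2 F(x_0,0) + o(t^2), \]
  where $X = \partial_t F(\cdot,0)$ is the generating vector field. The second-order coefficient
  depends only on the two flow lines at \<open>m\<close>, except for the term $DX(x_0)v$, which involves \<open>\<Phi>\<close> at
  nearby points. Let \<open>\<Phi>'\<close>, with representative $F'$ and generating field $X'$, be a flow that has the
  same arrow at \<open>m\<close>. The difference $Y = X - X'$ is again a section of \<open>H\<close>, and it vanishes at $x_0$.
  Hence $DY(x_0)v = \lim_{s\to 0} Y(x_0+sv)/s$ is a limit of vectors of \<open>H\<close> at points that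
  converge to \<open>m\<close>. Since \<open>H\<close> has continuous local frames of constant rank, such a limit lies in $H_m$
  (\<open>limit_in_span\<close>, \<open>limit_of_H_vectors\<close>), that is, in $\mathbb{R}^p\times\{0\}$
  (\<open>generator_difference_derivative\<close>). So the transverse components agree.

  To make the expansion rigorous, let $\bar g$ be the flow line at \<open>m\<close> of a flow \<open>\<Psi>'\<close> that has the same
  arrow as \<open>\<Psi>\<close>. For a transverse component $i$, the mean value theorem in the time variable, applied
  to the difference of the two flows, gives
  \[ F_i(g(t),t) - F'_i(\bar g(t),t) = g_i(t) - \bar g_i(t)
      + t\,\bigl(\partial_t F_i(g(t),\theta) - \partial_t F'_i(\bar g(t),\theta)\bigr) \]
  with $|\theta|\le|t|$. First-order expansion of $\partial_tF_i$ and $\partial_tF'_i$ at $(x_0,0)$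
  shows that the last term is $o(t^2)$ (\<open>diagonal_second_order\<close>). The difference $g_i-\bar g_i$
  is $o(t^2)$ because the arrows of \<open>\<Psi>\<close> and \<open>\<Psi>'\<close> agree. A smooth function that is $o(t^2)$ has zero
  second derivative (\<open>second_order_limit\<close>).

  Equivalence of curves is a condition in every $H$-chart, and the whole argument takes place in one
  arbitrary $H$-chart, from hypotheses to conclusion.\<close>

section \<open>Calculus of $C^k$ maps\<close>

lemma Ck_on_subset: "Ck_on k f S \<Longrightarrow> T \<subseteq> S \<Longrightarrow> Ck_on k f T"
  by (induction k arbitrary: f) (auto intro: continuous_on_subset)

lemma frechet_derivative_cong_open:
  assumes "open S" "x \<in> S" "\<And>y. y \<in> S \<Longrightarrow> f y = g y" "f differentiable (at x)"
  shows "frechet_derivative f (at x) = frechet_derivative g (at x)" "g differentiable (at x)"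
proof -
  have "(f has_derivative frechet_derivative f (at x)) (at x)"
    using assms(4) by (simp add: frechet_derivative_works)
  then have *: "(g has_derivative frechet_derivative f (at x)) (at x)"
    by (rule has_derivative_transform_within_open[OF _ assms(1,2)]) (simp add: assms(3))
  then show "frechet_derivative f (at x) = frechet_derivative g (at x)"
    by (rule frechet_derivative_at)
  show "g differentiable (at x)" using * by (auto simp: differentiable_def)
qed

lemma Ck_on_cong_imp:
  assumes "open S" "\<And>x. x \<in> S \<Longrightarrow> f x = g x" "Ck_on k f S"
  shows "Ck_on k g S"
  using assms(2,3)
proof (induction k arbitrary: f g)
  case 0
  then show ?case by (metis Ck_on.simps(1) continuous_on_cong)
next
  case (Suc k)
  then have d: "\<forall>x\<in>S. f differentiable (at x)" by simp
  have eq: "frechet_derivative f (at x) = frechet_derivative g (at x)"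
    and dg: "g differentiable (at x)" if "x \<in> S" for x
    using frechet_derivative_cong_open[OF assms(1) that Suc.prems(1)] d that by auto
  have "Ck_on k (\<lambda>x. frechet_derivative g (at x) v) S" for v
    using Suc.IH[of "\<lambda>x. frechet_derivative f (at x) v" "\<lambda>x. frechet_derivative g (at x) v"]
      Suc.prems(2) by (simp add: eq)
  then show ?case using dg by simp
qed

text \<open>Smoothness of a map between manifolds has to be checked with a different intermediate chart at
  each point, so it must be a local property.\<close>

lemma Ck_on_local:
  assumes "\<And>x. x \<in> S \<Longrightarrow> \<exists>T. open T \<and> x \<in> T \<and> Ck_on k f T"
  shows "Ck_on k f S"
  using assms
proof (induction k arbitrary: f)
  case 0
  have "continuous (at x) f" if "x \<in> S" for x
    using 0[OF that] by (auto simp: continuous_on_eq_continuous_at)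
  then show ?case by (simp add: continuous_at_imp_continuous_on)
next
  case (Suc k)
  have "\<forall>x\<in>S. f differentiable (at x)" using Suc.prems by force
  moreover have "Ck_on k (\<lambda>x. frechet_derivative f (at x) v) S" for v
    by (rule Suc.IH) (use Suc.prems in force)
  ultimately show ?case by simp
qed

lemma Ck_on_Suc_imp: "Ck_on (Suc k) f S \<Longrightarrow> Ck_on k f S"
proof (induction k arbitrary: f)
  case 0
  then show ?case
    by (auto intro!: continuous_at_imp_continuous_on differentiable_imp_continuous_within)
next
  case (Suc k)
  then show ?case by auto
qed

lemma Ck_on_const: "Ck_on k (\<lambda>x. c) S"
proof (induction k arbitrary: c)
  case (Suc k)
  have "frechet_derivative (\<lambda>x::'a. c) (at x) v = 0" for x v
    by (simp add: frechet_derivative_const)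
  then show ?case using Suc by simp
qed simp

lemma Ck_on_bounded_linear: "bounded_linear f \<Longrightarrow> Ck_on k f S"
proof (cases k)
  case (Suc j)
  assume f: "bounded_linear f"
  have "frechet_derivative f (at x) v = f v" for x v
    using frechet_derivative_at[OF bounded_linear_imp_has_derivative[OF f]] by metis
  then show ?thesis using Suc bounded_linear_imp_differentiable[OF f] by (simp add: Ck_on_const)
qed (simp add: linear_continuous_on)

lemma Ck_on_bounded_linear_compose:
  assumes "bounded_linear L" "open S" "Ck_on k f S"
  shows "Ck_on k (\<lambda>x. L (f x)) S"
  using assms(3)
proof (induction k arbitrary: f)
  case 0
  then show ?case by (simp add: bounded_linear.continuous_on[OF assms(1)])
next
  case (Suc k)
  have D: "((\<lambda>x. L (f x)) has_derivative (\<lambda>v. L (frechet_derivative f (at x) v))) (at x)"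
    if "x \<in> S" for x
    using Suc.prems that
    by (intro bounded_linear.has_derivative[OF assms(1)]) (simp add: frechet_derivative_works[symmetric])
  have "Ck_on k (\<lambda>x. frechet_derivative (\<lambda>x. L (f x)) (at x) v) S" for v
  proof (rule Ck_on_cong_imp[OF assms(2)])
    show "Ck_on k (\<lambda>x. L (frechet_derivative f (at x) v)) S"
      using Suc by simp
    show "\<And>x. x \<in> S \<Longrightarrow>
         L (frechet_derivative f (at x) v) = frechet_derivative (\<lambda>x. L (f x)) (at x) v"
      by (simp add: frechet_derivative_at[OF D, symmetric])
  qed
  then show ?case using D by (auto simp: differentiable_def)
qed

lemma Ck_on_add:
  assumes "open S" "Ck_on k f S" "Ck_on k g S"
  shows "Ck_on k (\<lambda>x. f x + g x) S"
  using assms(2,3)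
proof (induction k arbitrary: f g)
  case 0
  then show ?case by (simp add: continuous_on_add)
next
  case (Suc k)
  have D: "((\<lambda>x. f x + g x) has_derivative
      (\<lambda>v. frechet_derivative f (at x) v + frechet_derivative g (at x) v)) (at x)"
    if "x \<in> S" for x
    using Suc.prems that
    by (intro has_derivative_add) (simp_all add: frechet_derivative_works[symmetric])
  have "Ck_on k (\<lambda>x. frechet_derivative (\<lambda>x. f x + g x) (at x) v) S" for v
  proof (rule Ck_on_cong_imp[OF assms(1)])
    show "Ck_on k (\<lambda>x. frechet_derivative f (at x) v + frechet_derivative g (at x) v) S"
      using Suc by simp
    show "\<And>x. x \<in> S \<Longrightarrow> frechet_derivative f (at x) v + frechet_derivative g (at x) v
        = frechet_derivative (\<lambda>x. f x + g x) (at x) v"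
      by (simp add: frechet_derivative_at[OF D, symmetric])
  qed
  then show ?case using D by (auto simp: differentiable_def)
qed

lemma Ck_on_sum:
  assumes "open S" "finite I" "\<And>i. i \<in> I \<Longrightarrow> Ck_on k (f i) S"
  shows "Ck_on k (\<lambda>x. \<Sum>i\<in>I. f i x) S"
  using assms(2,3)
  by (induction I rule: finite_induct) (auto simp: Ck_on_const intro!: Ck_on_add[OF assms(1)])

lemma Ck_on_scaleR:
  fixes f :: "'a::real_normed_vector \<Rightarrow> real"
  assumes "open S" "Ck_on k f S" "Ck_on k g S"
  shows "Ck_on k (\<lambda>x. f x *\<^sub>R g x) S"
  using assms(2,3)
proof (induction k arbitrary: f g)
  case 0
  then show ?case by (simp add: continuous_on_scaleR)
next
  case (Suc k)
  have D: "((\<lambda>x. f x *\<^sub>R g x) has_derivative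
      (\<lambda>v. f x *\<^sub>R frechet_derivative g (at x) v + frechet_derivative f (at x) v *\<^sub>R g x)) (at x)"
    if "x \<in> S" for x
    using Suc.prems that
    by (intro has_derivative_scaleR) (simp_all add: frechet_derivative_works[symmetric])
  have "Ck_on k (\<lambda>x. frechet_derivative (\<lambda>x. f x *\<^sub>R g x) (at x) v) S" for v
  proof (rule Ck_on_cong_imp[OF assms(1)])
    show "Ck_on k (\<lambda>x. f x *\<^sub>R frechet_derivative g (at x) v + frechet_derivative f (at x) v *\<^sub>R g x) S"
      using Suc Ck_on_Suc_imp[of k f S] Ck_on_Suc_imp[of k g S]
      by (intro Ck_on_add[OF assms(1)] Suc.IH) auto
    show "\<And>x. x \<in> S \<Longrightarrow>
        f x *\<^sub>R frechet_derivative g (at x) v + frechet_derivative f (at x) v *\<^sub>R g x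
        = frechet_derivative (\<lambda>x. f x *\<^sub>R g x) (at x) v"
      by (simp add: frechet_derivative_at[OF D, symmetric])
  qed
  then show ?case using D by (auto simp: differentiable_def)
qed

text \<open>By the chain rule, the derivative of the composition in direction \<open>v\<close> is the sum over the basis
  of the real coefficients of $Df(x)v$ times the directional derivatives of \<open>g\<close> at $f(x)$. Each
  factor is of class $C^k$: the coefficients because \<open>f\<close> is $C^{k+1}$, and the derivatives of \<open>g\<close> by
  induction, which is why \<open>g\<close> is generalised and \<open>f\<close> is not.\<close>

lemma Ck_on_compose:
  fixes f :: "'a::real_normed_vector \<Rightarrow> 'b::euclidean_space"
  assumes "open S" "open T" "f ` S \<subseteq> T" "Ck_on k f S" "Ck_on k g T"
  shows "Ck_on k (\<lambda>x. g (f x)) S"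
  using assms(4,5)
proof (induction k arbitrary: g)
  case 0
  then show ?case using assms(3) by (auto intro: continuous_on_compose2)
next
  case (Suc k)
  have Df: "(f has_derivative frechet_derivative f (at x)) (at x)" if "x \<in> S" for x
    using Suc.prems that by (simp add: frechet_derivative_works[symmetric])
  have Dg: "(g has_derivative frechet_derivative g (at (f x))) (at (f x))" if "x \<in> S" for x
    using Suc.prems that assms(3) by (auto simp: frechet_derivative_works[symmetric])
  have D: "((\<lambda>x. g (f x)) has_derivative
      (\<lambda>v. frechet_derivative g (at (f x)) (frechet_derivative f (at x) v))) (at x)"
    if "x \<in> S" for x
    using has_derivative_compose[OF Df[OF that] Dg[OF that]] .
  have "Ck_on k (\<lambda>x. frechet_derivative (\<lambda>x. g (f x)) (at x) v) S" for v
  proof (rule Ck_on_cong_imp[OF assms(1)])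
    show "Ck_on k (\<lambda>x. \<Sum>b\<in>Basis. (frechet_derivative f (at x) v \<bullet> b) *\<^sub>R
        frechet_derivative g (at (f x)) b) S"
      using Suc.prems
      by (intro Ck_on_sum Ck_on_scaleR assms(1) Suc.IH Ck_on_Suc_imp[of k f S]
          Ck_on_bounded_linear_compose[OF bounded_linear_inner_left]) auto
    fix x assume x: "x \<in> S"
    have lin: "linear (frechet_derivative g (at (f x)))"
      using Dg[OF x] has_derivative_linear by blast
    have "frechet_derivative (\<lambda>x. g (f x)) (at x) v
        = frechet_derivative g (at (f x)) (frechet_derivative f (at x) v)"
      using frechet_derivative_at[OF D[OF x]] by metis
    also have "\<dots> = frechet_derivative g (at (f x))
        (\<Sum>b\<in>Basis. (frechet_derivative f (at x) v \<bullet> b) *\<^sub>R b)"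
      by (simp add: euclidean_representation)
    also have "\<dots> = (\<Sum>b\<in>Basis. (frechet_derivative f (at x) v \<bullet> b) *\<^sub>R
        frechet_derivative g (at (f x)) b)"
      by (simp add: linear_sum[OF lin] linear_scale[OF lin])
    finally show "(\<Sum>b\<in>Basis. (frechet_derivative f (at x) v \<bullet> b) *\<^sub>R
        frechet_derivative g (at (f x)) b) = frechet_derivative (\<lambda>x. g (f x)) (at x) v" ..
  qed
  then show ?case using D by (auto simp: differentiable_def)
qed

lemma Ck_on_Pair:
  assumes "open S" "Ck_on k f S" "Ck_on k g S"
  shows "Ck_on k (\<lambda>x. (f x, g x)) S"
proof -
  have "Ck_on k (\<lambda>x. (f x, 0) + (0, g x)) S"
    by (intro Ck_on_add[OF assms(1)] assms(2,3)
        Ck_on_bounded_linear_compose[where L="\<lambda>y. (y, 0)"]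
        Ck_on_bounded_linear_compose[where L="\<lambda>y. (0, y)"] assms(1)
        bounded_linear_Pair bounded_linear_ident bounded_linear_zero)
  then show ?thesis by simp
qed

lemma smooth_on_imp_differentiable:
  "smooth_on f S \<Longrightarrow> x \<in> S \<Longrightarrow> f differentiable (at x)"
  unfolding smooth_on_def by (metis Ck_on.simps(2))

lemma smooth_on_frechet_derivative:
  "smooth_on f S \<Longrightarrow> smooth_on (\<lambda>x. frechet_derivative f (at x) v) S"
  unfolding smooth_on_def by (metis Ck_on.simps(2))

section \<open>Smooth maps between manifolds\<close>

text \<open>The topological part of being an atlas. It is what composition of smooth maps relies on, and it
  passes to products, so that the product with the time axis can be treated like any other manifold.\<close>

definition charted ::
    "('m::topological_space, 'e::euclidean_space) chart set \<Rightarrow> bool" where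
  "charted A \<longleftrightarrow> (\<forall>\<kappa>\<in>A. topological_chart \<kappa>) \<and> (\<Union>\<kappa>\<in>A. fst \<kappa>) = UNIV"

lemma smooth_atlas_charted: "smooth_atlas A \<Longrightarrow> charted A"
  by (simp add: smooth_atlas_def charted_def)

lemma inv_into_UNIV_ident [simp]: "inv_into UNIV (\<lambda>x. x) = (\<lambda>x. x)"
  by (rule ext, rule inv_f_eq) (auto simp: inj_on_def)

lemma charted_euclidean: "charted euclidean_atlas"
  by (simp add: charted_def euclidean_atlas_def topological_chart_def homeomorphism_def)

lemma charted_cases:
  assumes "charted A"
  obtains U \<phi> where "(U, \<phi>) \<in> A" "m \<in> U"
proof -
  have "m \<in> (\<Union>\<kappa>\<in>A. fst \<kappa>)" using assms by (simp add: charted_def)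
  then show ?thesis using that by force
qed

lemma topological_chartD:
  assumes "topological_chart (U, \<phi>)"
  shows "open U" "open (\<phi> ` U)" "continuous_on U \<phi>" "continuous_on (\<phi> ` U) (inv_into U \<phi>)"
    "inj_on \<phi> U" "\<And>x. x \<in> U \<Longrightarrow> inv_into U \<phi> (\<phi> x) = x"
proof -
  show "\<And>x. x \<in> U \<Longrightarrow> inv_into U \<phi> (\<phi> x) = x"
    using assms by (auto simp: topological_chart_def homeomorphism_def)
  then show "inj_on \<phi> U" by (metis inj_on_inverseI)
qed (use assms in \<open>auto simp: topological_chart_def homeomorphism_def\<close>)

lemma chart_image_open:
  assumes "topological_chart (U, \<phi>)" "open G"
  shows "open (\<phi> ` (U \<inter> G))"
proof -
  note c = topological_chartD[OF assms(1)]
  have "\<phi> ` (U \<inter> G) = \<phi> ` U \<inter> inv_into U \<phi> -` G" using c(6) by auto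
  then show ?thesis using continuous_open_preimage[OF c(4,2) assms(2)] by simp
qed

lemma charted_prod_atlas:
  assumes "charted A" "charted B"
  shows "charted (prod_atlas A B)"
proof -
  have "topological_chart (U \<times> W, map_prod \<phi> \<psi>)" if "(U, \<phi>) \<in> A" "(W, \<psi>) \<in> B" for U \<phi> W \<psi>
  proof -
    have "topological_chart (U, \<phi>)" "topological_chart (W, \<psi>)" using assms that by (auto simp: charted_def)
    note c = topological_chartD[OF this(1)] and d = topological_chartD[OF this(2)]
    have inj: "inj_on (map_prod \<phi> \<psi>) (U \<times> W)" using c(5) d(5) by (rule map_prod_inj_on)
    have im: "map_prod \<phi> \<psi> ` (U \<times> W) = \<phi> ` U \<times> \<psi> ` W" by (rule map_prod_surj_on) auto
    have inv: "inv_into (U \<times> W) (map_prod \<phi> \<psi>) z = (inv_into U \<phi> (fst z), inv_into W \<psi> (snd z))"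
      if "z \<in> \<phi> ` U \<times> \<psi> ` W" for z
      using that by (intro inv_into_f_eq[OF inj]) (auto simp: c(6) d(6))
    have "continuous_on (\<phi> ` U \<times> \<psi> ` W) (\<lambda>z. (inv_into U \<phi> (fst z), inv_into W \<psi> (snd z)))"
      by (intro continuous_on_Pair continuous_on_compose2[OF c(4)] continuous_on_compose2[OF d(4)])
        (auto intro!: continuous_intros)
    then have "continuous_on (\<phi> ` U \<times> \<psi> ` W) (inv_into (U \<times> W) (map_prod \<phi> \<psi>))"
      by (rule continuous_on_eq) (simp add: inv)
    moreover have "continuous_on (U \<times> W) (map_prod \<phi> \<psi>)"
      unfolding map_prod_def split_beta
      by (intro continuous_on_Pair continuous_on_compose2[OF c(3)] continuous_on_compose2[OF d(3)])
        (auto intro!: continuous_intros)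
    moreover have "inv_into (U \<times> W) (map_prod \<phi> \<psi>) (\<phi> x, \<psi> y) = (x, y)" if "x \<in> U" "y \<in> W" for x y
      using that by (simp add: inv c(6) d(6))
    ultimately show ?thesis
      unfolding topological_chart_def using c d inj
      by (auto simp: im homeomorphism_def open_Times image_iff)
  qed
  moreover have "\<exists>\<kappa>\<in>prod_atlas A B. (x, y) \<in> fst \<kappa>" for x y
  proof -
    obtain U \<phi> W \<psi> where *: "(U, \<phi>) \<in> A" "x \<in> U" "(W, \<psi>) \<in> B" "y \<in> W"
      using assms by (metis charted_cases)
    then have "(U \<times> W, map_prod \<phi> \<psi>) \<in> prod_atlas A B" by (auto simp: prod_atlas_def)
    then show ?thesis using * by force
  qed
  ultimately show ?thesis unfolding charted_def by (auto simp: prod_atlas_def)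
qed

lemma smooth_on_subset: "smooth_on f S \<Longrightarrow> T \<subseteq> S \<Longrightarrow> smooth_on f T"
  unfolding smooth_on_def by (blast intro: Ck_on_subset)

lemma smooth_on_cong_imp:
  "open S \<Longrightarrow> (\<And>x. x \<in> S \<Longrightarrow> f x = g x) \<Longrightarrow> smooth_on f S \<Longrightarrow> smooth_on g S"
  unfolding smooth_on_def by (blast intro: Ck_on_cong_imp)

lemma smooth_on_local:
  "(\<And>x. x \<in> S \<Longrightarrow> \<exists>T. open T \<and> x \<in> T \<and> smooth_on f T) \<Longrightarrow> smooth_on f S"
  unfolding smooth_on_def by (intro allI Ck_on_local) metis

lemma smooth_on_compose:
  fixes f :: "'a::real_normed_vector \<Rightarrow> 'b::euclidean_space"
  shows "open S \<Longrightarrow> open T \<Longrightarrow> f ` S \<subseteq> T \<Longrightarrow> smooth_on f S \<Longrightarrow> smooth_on g T \<Longrightarrow>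
    smooth_on (\<lambda>x. g (f x)) S"
  unfolding smooth_on_def by (blast intro: Ck_on_compose)

lemma smooth_on_imp_continuous_on: "smooth_on f S \<Longrightarrow> continuous_on S f"
  unfolding smooth_on_def by (metis Ck_on.simps(1))

lemma smooth_on_bounded_linear: "bounded_linear f \<Longrightarrow> smooth_on f S"
  by (simp add: smooth_on_def Ck_on_bounded_linear)

lemma smooth_map_euclidean_iff [simp]:
  "smooth_map euclidean_atlas euclidean_atlas f S \<longleftrightarrow> smooth_on f S"
  by (auto simp: smooth_map_def euclidean_atlas_def smooth_on_imp_continuous_on)

lemma smooth_map_subset:
  assumes "smooth_map A B f S" "T \<subseteq> S"
  shows "smooth_map A B f T"
proof -
  have "\<phi> ` (U \<inter> T \<inter> f -` W) \<subseteq> \<phi> ` (U \<inter> S \<inter> f -` W)" for U W and \<phi> :: "'a \<Rightarrow> 'c"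
    using assms(2) by blast
  then show ?thesis
    using assms unfolding smooth_map_def
    by (fastforce intro: continuous_on_subset smooth_on_subset)
qed

lemma smooth_map_cong_imp:
  assumes A: "charted A" and B: "charted B" and S: "open S"
    and eq: "\<And>x. x \<in> S \<Longrightarrow> f x = g x" and f: "smooth_map A B f S"
  shows "smooth_map A B g S"
proof -
  have cf: "continuous_on S f" using f by (simp add: smooth_map_def)
  then have cg: "continuous_on S g" by (rule continuous_on_eq) (rule eq)
  have "smooth_on (\<lambda>x. \<psi> (g (inv_into U \<phi> x))) (\<phi> ` (U \<inter> S \<inter> g -` W))"
    if U: "(U, \<phi>) \<in> A" and W: "(W, \<psi>) \<in> B" for U \<phi> W \<psi>
  proof -
    have tU: "topological_chart (U, \<phi>)" and oW: "open W"
      using A B U W by (auto simp: charted_def dest: topological_chartD(1))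
    have e: "U \<inter> S \<inter> g -` W = U \<inter> (S \<inter> f -` W)" using eq by auto
    have "open (\<phi> ` (U \<inter> (S \<inter> f -` W)))"
      by (intro chart_image_open[OF tU] continuous_open_preimage[OF cf S oW])
    then show ?thesis unfolding e
      by (rule smooth_on_cong_imp[of _ "\<lambda>x. \<psi> (f (inv_into U \<phi> x))"])
        (use f U W eq topological_chartD(6)[OF tU] in \<open>auto simp: smooth_map_def Int_assoc\<close>)
  qed
  then show ?thesis using cg by (auto simp: smooth_map_def)
qed

text \<open>Near each point the local representative factors through a chart of the middle manifold, and
  the second factor is smooth on an open set that contains the image of the first.\<close>

lemma smooth_map_compose:
  assumes A: "charted A" and B: "charted B" and C: "charted C"
    and S: "open S" and T: "open T" and fS: "f ` S \<subseteq> T"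
    and f: "smooth_map A B f S" and g: "smooth_map B C g T"
  shows "smooth_map A C (\<lambda>x. g (f x)) S"
proof -
  have cf: "continuous_on S f" and cg: "continuous_on T g"
    using f g by (auto simp: smooth_map_def)
  have cgf: "continuous_on S (\<lambda>x. g (f x))"
    using continuous_on_compose2[OF cg cf] fS by auto
  moreover have "smooth_on (\<lambda>x. \<psi> (g (f (inv_into U \<phi> x)))) (\<phi> ` (U \<inter> S \<inter> (\<lambda>x. g (f x)) -` W))"
    if U: "(U, \<phi>) \<in> A" and W: "(W, \<psi>) \<in> C" for U \<phi> W \<psi>
  proof (rule smooth_on_local)
    fix x assume "x \<in> \<phi> ` (U \<inter> S \<inter> (\<lambda>x. g (f x)) -` W)"
    then obtain u where u: "x = \<phi> u" "u \<in> U" "u \<in> S" "g (f u) \<in> W" by auto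
    obtain Z \<zeta> where Z: "(Z, \<zeta>) \<in> B" "f u \<in> Z" using B by (metis charted_cases)
    have tU: "topological_chart (U, \<phi>)" and tW: "topological_chart (W, \<psi>)"
      and tZ: "topological_chart (Z, \<zeta>)"
      using A B C U W Z by (auto simp: charted_def)
    note cU = topological_chartD[OF tU] and cW = topological_chartD[OF tW]
      and cZ = topological_chartD[OF tZ]
    define N where "N = \<phi> ` (U \<inter> ((S \<inter> f -` Z) \<inter> (S \<inter> (\<lambda>x. g (f x)) -` W)))"
    have oN: "open N" unfolding N_def
      by (intro chart_image_open[OF tU] open_Int continuous_open_preimage[OF cf S cZ(1)]
          continuous_open_preimage[OF cgf S cW(1)])
    define O' where "O' = \<zeta> ` (Z \<inter> (T \<inter> g -` W))"
    have oO: "open O'" unfolding O'_def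
      by (intro chart_image_open[OF tZ] continuous_open_preimage[OF cg T cW(1)])
    have h1: "smooth_on (\<lambda>x. \<zeta> (f (inv_into U \<phi> x))) N"
      by (rule smooth_on_subset[of _ "\<phi> ` (U \<inter> S \<inter> f -` Z)"])
        (use f U Z in \<open>auto simp: smooth_map_def N_def\<close>)
    have h2: "smooth_on (\<lambda>y. \<psi> (g (inv_into Z \<zeta> y))) O'"
      by (rule smooth_on_subset[of _ "\<zeta> ` (Z \<inter> T \<inter> g -` W)"])
        (use g W Z in \<open>auto simp: smooth_map_def O'_def\<close>)
    have "smooth_on (\<lambda>x. \<psi> (g (inv_into Z \<zeta> (\<zeta> (f (inv_into U \<phi> x)))))) N"
    proof (rule smooth_on_compose[OF oN oO _ h1 h2])
      show "(\<lambda>x. \<zeta> (f (inv_into U \<phi> x))) ` N \<subseteq> O'"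
        using fS by (auto simp: N_def O'_def cU(6))
    qed
    then have "smooth_on (\<lambda>x. \<psi> (g (f (inv_into U \<phi> x)))) N"
      by (rule smooth_on_cong_imp[OF oN, rotated]) (auto simp: N_def cU(6) cZ(6))
    moreover have "x \<in> N" using u Z by (auto simp: N_def)
    ultimately show "\<exists>N. open N \<and> x \<in> N \<and> smooth_on (\<lambda>x. \<psi> (g (f (inv_into U \<phi> x)))) N"
      using oN by blast
  qed
  ultimately show ?thesis by (auto simp: smooth_map_def)
qed

lemma smooth_map_Pair:
  assumes C: "charted C" and A: "charted A" and B: "charted B"
    and S: "open S" and f: "smooth_map C A f S" and g: "smooth_map C B g S"
  shows "smooth_map C (prod_atlas A B) (\<lambda>x. (f x, g x)) S"
proof -
  have cf: "continuous_on S f" and cg: "continuous_on S g"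
    using f g by (auto simp: smooth_map_def)
  have "smooth_on (\<lambda>x. map_prod \<phi> \<psi> (f (inv_into Z \<zeta> x), g (inv_into Z \<zeta> x)))
      (\<zeta> ` (Z \<inter> S \<inter> (\<lambda>x. (f x, g x)) -` (U \<times> W)))"
    if U: "(U, \<phi>) \<in> A" and W: "(W, \<psi>) \<in> B" and Z: "(Z, \<zeta>) \<in> C" for U \<phi> W \<psi> Z \<zeta>
  proof -
    have tZ: "topological_chart (Z, \<zeta>)" and oU: "open U" and oW: "open W"
      using A B C U W Z by (auto simp: charted_def dest: topological_chartD(1))
    have eq: "Z \<inter> S \<inter> (\<lambda>x. (f x, g x)) -` (U \<times> W) = Z \<inter> ((S \<inter> f -` U) \<inter> (S \<inter> g -` W))" by auto
    have oN: "open (\<zeta> ` (Z \<inter> S \<inter> (\<lambda>x. (f x, g x)) -` (U \<times> W)))" (is "open ?N")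
      unfolding eq
      by (intro chart_image_open[OF tZ] open_Int continuous_open_preimage[OF cf S oU]
          continuous_open_preimage[OF cg S oW])
    have "smooth_on (\<lambda>x. \<phi> (f (inv_into Z \<zeta> x))) ?N"
      by (rule smooth_on_subset[of _ "\<zeta> ` (Z \<inter> S \<inter> f -` U)"]) (use f U Z in \<open>auto simp: smooth_map_def\<close>)
    moreover have "smooth_on (\<lambda>x. \<psi> (g (inv_into Z \<zeta> x))) ?N"
      by (rule smooth_on_subset[of _ "\<zeta> ` (Z \<inter> S \<inter> g -` W)"]) (use g W Z in \<open>auto simp: smooth_map_def\<close>)
    ultimately show ?thesis by (simp add: smooth_on_def Ck_on_Pair[OF oN])
  qed
  then show ?thesis
    using continuous_on_Pair[OF cf cg] by (auto simp: smooth_map_def prod_atlas_def)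
qed

lemma smooth_map_const: "smooth_map C A (\<lambda>x. c) S"
  by (auto simp: smooth_map_def smooth_on_def Ck_on_const)

lemma smooth_map_snd:
  assumes A: "charted A" and S: "open S"
  shows "smooth_map (prod_atlas A euclidean_atlas) euclidean_atlas snd S"
proof -
  have "smooth_on (\<lambda>x. snd (inv_into (U \<times> UNIV) (map_prod \<phi> (\<lambda>x. x)) x))
      (map_prod \<phi> (\<lambda>x. x) ` (U \<times> UNIV \<inter> S))"
    if "(U, \<phi>) \<in> A" for U \<phi>
  proof -
    have "(U \<times> UNIV, map_prod \<phi> (\<lambda>x. x)) \<in> prod_atlas A euclidean_atlas"
      using that by (auto simp: prod_atlas_def euclidean_atlas_def)
    then have t: "topological_chart (U \<times> UNIV, map_prod \<phi> (\<lambda>x::'c. x))"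
      using charted_prod_atlas[OF A charted_euclidean] unfolding charted_def by blast
    show ?thesis
    proof (rule smooth_on_cong_imp[OF chart_image_open[OF t S], of snd])
      show "smooth_on snd (map_prod \<phi> (\<lambda>x. x) ` (U \<times> UNIV \<inter> S))"
        by (rule smooth_on_bounded_linear[OF bounded_linear_snd])
      fix x :: "'b \<times> 'c" assume "x \<in> map_prod \<phi> (\<lambda>x. x) ` (U \<times> UNIV \<inter> S)"
      then obtain u where u: "x = map_prod \<phi> (\<lambda>x. x) u" "u \<in> U \<times> UNIV \<inter> S" by (rule imageE)
      show "snd x = snd (inv_into (U \<times> UNIV) (map_prod \<phi> (\<lambda>x. x)) x)"
        using topological_chartD(6)[OF t, of u] u by simp
    qed
  qed
  moreover have "continuous_on S snd" by (intro continuous_intros)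
  ultimately show ?thesis
    by (auto simp: smooth_map_def prod_atlas_def euclidean_atlas_def)
qed

lemma smooth_atlas_coordinate_chart:
  "smooth_atlas A \<Longrightarrow> \<kappa> \<in> A \<Longrightarrow> coordinate_chart A \<kappa>"
  by (simp add: smooth_atlas_def coordinate_chart_def)

text \<open>A coordinate chart that is not in the atlas, such as an $H$-chart, becomes an ordinary smooth map
  to Euclidean space. Local representatives in it are then compositions of smooth maps.\<close>

lemma smooth_map_chart:
  assumes "coordinate_chart A (U, \<phi>)"
  shows "smooth_map A euclidean_atlas \<phi> U"
proof -
  have "topological_chart (U, \<phi>)" using assms by (simp add: coordinate_chart_def)
  note c = topological_chartD[OF this]
  have "smooth_on (\<lambda>x. \<phi> (inv_into W \<psi> x)) (\<psi> ` (W \<inter> U))" if "(W, \<psi>) \<in> A" for W \<psi>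
    using assms that by (auto simp: coordinate_chart_def compatible_def Int_commute)
  then show ?thesis using c(3) by (auto simp: smooth_map_def euclidean_atlas_def)
qed

lemma smooth_map_chart_inverse:
  assumes "coordinate_chart A (U, \<phi>)"
  shows "smooth_map euclidean_atlas A (inv_into U \<phi>) (\<phi> ` U)"
proof -
  have "topological_chart (U, \<phi>)" using assms by (simp add: coordinate_chart_def)
  note c = topological_chartD[OF this]
  have "\<phi> ` U \<inter> inv_into U \<phi> -` W = \<phi> ` (U \<inter> W)" for W using c(6) by auto
  then have "smooth_on (\<lambda>x. \<psi> (inv_into U \<phi> x)) (\<phi> ` U \<inter> inv_into U \<phi> -` W)" if "(W, \<psi>) \<in> A" for W \<psi>
    using assms that by (auto simp: coordinate_chart_def compatible_def)
  then show ?thesis using c(4) by (auto simp: smooth_map_def euclidean_atlas_def)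
qed

section \<open>Composition of local flows\<close>

lemma smooth_map_compose_preimage:
  assumes "charted A" "charted B" "charted C" "open S" "open T"
    and "smooth_map A B f S" "smooth_map B C g T"
  shows "open (S \<inter> f -` T)" "smooth_map A C (\<lambda>x. g (f x)) (S \<inter> f -` T)"
proof -
  show o: "open (S \<inter> f -` T)"
    using assms by (intro continuous_open_preimage) (auto simp: smooth_map_def)
  show "smooth_map A C (\<lambda>x. g (f x)) (S \<inter> f -` T)"
    by (rule smooth_map_compose[OF assms(1-3) o assms(5) _ smooth_map_subset[OF assms(6)] assms(7)]) auto
qed

lemma local_diffeo_compose:
  assumes A: "charted A" and g: "local_diffeo A g S" and f: "local_diffeo A f T"
  shows "local_diffeo A (\<lambda>m. f (g m)) {m \<in> S. g m \<in> T}"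
  unfolding local_diffeo_def
proof
  fix m assume "m \<in> {m \<in> S. g m \<in> T}"
  then have m: "m \<in> S" "g m \<in> T" by auto
  obtain U where U: "open U" "m \<in> U" "U \<subseteq> S" "inj_on g U" "open (g ` U)"
    "smooth_map A A g U" "smooth_map A A (inv_into U g) (g ` U)"
    using g m unfolding local_diffeo_def by metis
  obtain O' where O': "open O'" "g m \<in> O'" "O' \<subseteq> T" "inj_on f O'" "open (f ` O')"
    "smooth_map A A f O'" "smooth_map A A (inv_into O' f) (f ` O')"
    using f m unfolding local_diffeo_def by metis
  define D where "D = U \<inter> g -` O'"
  note 1 = smooth_map_compose_preimage[OF A A A U(1) O'(1) U(6) O'(6), folded D_def]
  note 2 = smooth_map_compose_preimage[OF A A A O'(5) U(5) O'(7) U(7)]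
  have im: "(\<lambda>m. f (g m)) ` D = f ` O' \<inter> inv_into O' f -` (g ` U)"
    using O'(4) by (force simp: D_def)
  have inj: "inj_on (\<lambda>m. f (g m)) D"
    using U(4) O'(4) by (auto simp: D_def inj_on_def)
  have inv: "inv_into D (\<lambda>m. f (g m)) y = inv_into U g (inv_into O' f y)"
    if "y \<in> f ` O' \<inter> inv_into O' f -` (g ` U)" for y
    using that U(4) O'(4) by (intro inv_into_f_eq[OF inj]) (auto simp: D_def)
  have "smooth_map A A (inv_into D (\<lambda>m. f (g m))) ((\<lambda>m. f (g m)) ` D)"
    unfolding im by (rule smooth_map_cong_imp[OF A A 2(1) inv[symmetric] 2(2)])
  then show "\<exists>U. open U \<and> m \<in> U \<and> U \<subseteq> {m \<in> S. g m \<in> T} \<and> inj_on (\<lambda>m. f (g m)) U \<and>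
      open ((\<lambda>m. f (g m)) ` U) \<and> smooth_map A A (\<lambda>m. f (g m)) U \<and>
      smooth_map A A (inv_into U (\<lambda>m. f (g m))) ((\<lambda>m. f (g m)) ` U)"
    using 1 2(1)[folded im] inj U(2,3) O'(2,3) by (intro exI[of _ D]) (auto simp: D_def)
qed

lemma local_flowD:
  assumes "local_flow A V \<Phi>"
  shows "open V" "smooth_map (prod_atlas A euclidean_atlas) A \<Phi> V"
    "(m, 0) \<in> V \<Longrightarrow> \<Phi> (m, 0) = m" "local_diffeo A (\<lambda>m. \<Phi> (m, t)) {m. (m, t) \<in> V}"
  using assms by (auto simp: local_flow_def)

lemma smooth_on_ident: "smooth_on (\<lambda>x. x) S"
  by (simp add: smooth_on_bounded_linear bounded_linear_ident)

lemma flow_line_smooth_map: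
  assumes "charted A" "local_flow A V \<Phi>"
  shows "open {t. (m, t) \<in> V}" "smooth_map euclidean_atlas A (flow_line \<Phi> m) {t. (m, t) \<in> V}"
proof -
  note f = local_flowD[OF assms(2)]
  have "smooth_map euclidean_atlas (prod_atlas A euclidean_atlas) (\<lambda>t. (m, t)) (UNIV::real set)"
    by (intro smooth_map_Pair assms(1) charted_euclidean smooth_map_const) (auto simp: smooth_on_ident)
  note * = smooth_map_compose_preimage[OF charted_euclidean
      charted_prod_atlas[OF assms(1) charted_euclidean] assms(1) open_UNIV f(1) this f(2)]
  then show "open {t. (m, t) \<in> V}" "smooth_map euclidean_atlas A (flow_line \<Phi> m) {t. (m, t) \<in> V}"
    by (auto simp: vimage_def flow_line_def)
qed

lemma flow_line_smooth_curve:
  assumes "charted A" "local_flow A V \<Phi>" "(m, 0) \<in> V"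
  shows "smooth_curve A (flow_line \<Phi> m)"
proof -
  note * = flow_line_smooth_map[OF assms(1,2), of m]
  obtain e where "e > 0" "ball 0 e \<subseteq> {t. (m, t) \<in> V}"
    using *(1) assms(3) openE[of "{t. (m, t) \<in> V}" 0] by auto
  moreover have "ball 0 e = {-e<..<e}" by (simp add: ball_eq_greaterThanLessThan)
  ultimately show ?thesis
    unfolding smooth_curve_def using smooth_map_subset[OF *(2)] by metis
qed

lemma eventually_flow_line_in:
  assumes "charted A" "local_flow A V \<Phi>" "(m, 0) \<in> V" "open G" "m \<in> G"
  shows "eventually (\<lambda>t. \<Phi> (m, t) \<in> G) (nhds 0)"
proof -
  note * = flow_line_smooth_map[OF assms(1,2), of m]
  have "open ({t. (m, t) \<in> V} \<inter> flow_line \<Phi> m -` G)"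
    using * assms(4) by (intro continuous_open_preimage) (auto simp: smooth_map_def)
  moreover have "0 \<in> {t. (m, t) \<in> V} \<inter> flow_line \<Phi> m -` G"
    using assms local_flowD(3)[OF assms(2,3)] by (simp add: flow_line_def)
  ultimately have "eventually (\<lambda>t. t \<in> {t. (m, t) \<in> V} \<inter> flow_line \<Phi> m -` G) (nhds 0)"
    by (rule eventually_nhds_in_open)
  then show ?thesis by eventually_elim (simp add: flow_line_def)
qed

text \<open>The germ of a curve at $0$ is all that matters here, so the neighbourhood is left unspecified.\<close>

lemma smooth_along_curve:
  assumes "charted A" "open G" "c 0 \<in> G" "smooth_map A euclidean_atlas f G" "smooth_curve A c"
  shows "\<exists>N. open N \<and> 0 \<in> N \<and> smooth_on (\<lambda>t. f (c t)) N"
proof -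
  obtain e where e: "e > 0" "smooth_map euclidean_atlas A c {-e<..<e}"
    using assms(5) by (auto simp: smooth_curve_def)
  note * = smooth_map_compose_preimage[OF charted_euclidean assms(1) charted_euclidean _ assms(2)
      e(2) assms(4)]
  then show ?thesis using assms(3) e(1) by (intro exI[of _ "{-e<..<e} \<inter> c -` G"]) auto
qed

lemma flow_in_chart_smooth:
  assumes A: "charted A" and \<phi>: "coordinate_chart A (U, \<phi>)" and \<Phi>: "local_flow A V \<Phi>"
    and G: "open G" and f: "smooth_map A euclidean_atlas f G" and m: "m \<in> U" "(m, 0) \<in> V" "m \<in> G"
  shows "\<exists>N. open N \<and> (\<phi> m, 0) \<in> N \<and> smooth_on (\<lambda>z. f (\<Phi> (inv_into U \<phi> (fst z), snd z))) N"
proof -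
  note fl = local_flowD[OF \<Phi>]
  have "topological_chart (U, \<phi>)" using \<phi> by (simp add: coordinate_chart_def)
  note c = topological_chartD[OF this]
  let ?S = "\<phi> ` U \<times> (UNIV :: real set)"
  have oS: "open ?S" using c(2) by (simp add: open_Times)
  note E = charted_euclidean
  note P = charted_prod_atlas[OF A charted_euclidean]
  have "smooth_map euclidean_atlas A (\<lambda>z. inv_into U \<phi> (fst z)) ?S"
    by (rule smooth_map_compose[OF E E A oS c(2) _ _ smooth_map_chart_inverse[OF \<phi>]])
      (auto intro: smooth_on_bounded_linear bounded_linear_fst)
  then have Q: "smooth_map euclidean_atlas (prod_atlas A euclidean_atlas)
      (\<lambda>z. (inv_into U \<phi> (fst z), snd z)) ?S"
    by (intro smooth_map_Pair E A oS)
      (auto intro: smooth_on_bounded_linear bounded_linear_snd)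
  note R = smooth_map_compose_preimage[OF E P A oS fl(1) Q fl(2)]
  note T = smooth_map_compose_preimage[OF E A E R(1) G R(2) f]
  then show ?thesis
    using m c(6) fl(3)[OF m(2)]
    by (intro exI[of _ "?S \<inter> (\<lambda>z. (inv_into U \<phi> (fst z), snd z)) -` V \<inter>
          (\<lambda>z. \<Phi> (inv_into U \<phi> (fst z), snd z)) -` G"]) auto
qed

text \<open>The chain rule along the curve $t\mapsto(g(t),t)$: its velocity splits into a spatial and a temporal
  part, and each part is the velocity of a simpler curve.\<close>

lemma has_derivative_diagonal:
  fixes F :: "'a::real_normed_vector \<times> real \<Rightarrow> real"
  assumes "F differentiable (at (g 0, 0))" "(g has_vector_derivative v) (at 0)"
  defines "D \<equiv> frechet_derivative F (at (g 0, 0))"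
  shows "((\<lambda>t. F (g t, 0)) has_real_derivative D (v, 0)) (at 0)"
    "((\<lambda>t. F (g 0, t)) has_real_derivative D (0, 1)) (at 0)"
    "((\<lambda>t. F (g t, t)) has_real_derivative D (v, 0) + D (0, 1)) (at 0)"
proof -
  have D: "(F has_derivative D) (at (g 0, 0))"
    using assms(1) by (simp add: D_def frechet_derivative_works)
  have lin: "linear D" using D has_derivative_linear by blast
  have *: "((\<lambda>t. F (\<gamma> t)) has_real_derivative D w) (at 0)"
    if "(\<gamma> has_vector_derivative w) (at 0)" "\<gamma> 0 = (g 0, 0)" for \<gamma> w
  proof -
    have "((\<lambda>t. F (\<gamma> t)) has_derivative (\<lambda>h. D (h *\<^sub>R w))) (at 0)"
      using that D by (intro has_derivative_compose[of \<gamma> _ _ _ F D]) (auto simp: has_vector_derivative_def)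
    then show ?thesis by (simp add: has_field_derivative_def linear_scale[OF lin] mult_commute_abs)
  qed
  have "((\<lambda>t. (g t, 0)) has_vector_derivative (v, 0)) (at 0)"
    "((\<lambda>t. (g 0, t)) has_vector_derivative (0, 1)) (at 0)"
    "((\<lambda>t. (g t, t)) has_vector_derivative (v, 1)) (at 0)"
    using assms(2) by (auto intro!: derivative_eq_intros has_vector_derivative_Pair)
  moreover have "D (v, 1) = D (v, 0) + D (0, 1)"
    using linear_add[OF lin, of "(v, 0)" "(0, 1)"] by simp
  ultimately show "((\<lambda>t. F (g t, 0)) has_real_derivative D (v, 0)) (at 0)"
    "((\<lambda>t. F (g 0, t)) has_real_derivative D (0, 1)) (at 0)"
    "((\<lambda>t. F (g t, t)) has_real_derivative D (v, 0) + D (0, 1)) (at 0)"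
    using *[of "\<lambda>t. (g t, 0)" "(v, 0)"] *[of "\<lambda>t. (g 0, t)" "(0, 1)"]
      *[of "\<lambda>t. (g t, t)" "(v, 1)"] by simp_all
qed

text \<open>Apply \<open>has_derivative_diagonal\<close> to $F(x,t)=f(\Phi_t(\phi^{-1}(x)))$ and $g(t)=\phi(\Psi_t(m))$. Since
  $\Phi_0$ is the identity, the spatial part is the derivative of \<open>f\<close> along the flow line of \<open>\<Psi>\<close>.\<close>

lemma velocity_flow_comp:
  assumes A: "smooth_atlas A" and \<Phi>: "local_flow A V \<Phi>" and \<Psi>: "local_flow A W \<Psi>"
    and m: "(m, 0) \<in> V" "(m, 0) \<in> W"
  shows "velocity A (flow_line (flow_comp \<Phi> \<Psi>) m)
    = velocity A (flow_line \<Phi> m) + velocity A (flow_line \<Psi> m)"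
proof
  fix f
  note cA = smooth_atlas_charted[OF A]
  note p = local_flowD(3)[OF \<Phi> m(1)] local_flowD(3)[OF \<Psi> m(2)]
  have m0: "flow_line (flow_comp \<Phi> \<Psi>) m 0 = m" "flow_line \<Phi> m 0 = m" "flow_line \<Psi> m 0 = m"
    using p by (auto simp: flow_line_def flow_comp_def)
  show "velocity A (flow_line (flow_comp \<Phi> \<Psi>) m) f
    = (velocity A (flow_line \<Phi> m) + velocity A (flow_line \<Psi> m)) f"
  proof (cases "smooth_near A m f")
    case False
    then show ?thesis by (simp add: velocity_def m0)
  next
    case True
    then obtain G where G: "open G" "m \<in> G" "smooth_map A euclidean_atlas f G"
      by (auto simp: smooth_near_def)
    obtain U \<phi> where U: "(U, \<phi>) \<in> A" "m \<in> U" using charted_cases[OF cA] .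
    note ch = smooth_atlas_coordinate_chart[OF A U(1)]
    have "topological_chart (U, \<phi>)" using ch by (simp add: coordinate_chart_def)
    note c = topological_chartD[OF this]
    define F where "F = (\<lambda>z. f (\<Phi> (inv_into U \<phi> (fst z), snd z)))"
    define g where "g = (\<lambda>t. \<phi> (\<Psi> (m, t)))"
    have g0: "g 0 = \<phi> m" by (simp add: g_def p)
    have F: "F differentiable (at (g 0, 0))"
      using flow_in_chart_smooth[OF cA ch \<Phi> G(1,3) U(2) m(1) G(2)]
      unfolding F_def g0 by (blast intro: smooth_on_imp_differentiable)
    have "g differentiable (at 0)"
      using smooth_along_curve[OF cA c(1) _ smooth_map_chart[OF ch]
          flow_line_smooth_curve[OF cA \<Psi> m(2)]] U(2)
      unfolding g_def flow_line_def by (auto simp: p intro: smooth_on_imp_differentiable)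
    then have g: "(g has_vector_derivative vector_derivative g (at 0)) (at 0)"
      by (simp add: vector_derivative_works[symmetric])
    note D = has_derivative_diagonal[OF F g]
    have ev: "\<forall>\<^sub>F t in nhds 0. \<Psi> (m, t) \<in> U \<inter> {x. (x, 0) \<in> V}"
    proof (rule eventually_flow_line_in[OF cA \<Psi> m(2)])
      have "open ((\<lambda>x. (x, 0)) -` V)"
        by (intro open_vimage local_flowD(1)[OF \<Phi>] continuous_intros)
      then show "open (U \<inter> {x. (x, 0) \<in> V})" using c(1) by (auto simp: vimage_def)
    qed (use U m in auto)
    have "deriv (\<lambda>t. f (flow_line \<Psi> m t)) 0 = frechet_derivative F (at (g 0, 0)) (vector_derivative g (at 0), 0)"
    proof -
      have e: "\<forall>\<^sub>F t in nhds 0. f (flow_line \<Psi> m t) = F (g t, 0)"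
        using ev by eventually_elim (auto simp: F_def g_def c(6) flow_line_def local_flowD(3)[OF \<Phi>])
      show ?thesis
        by (rule DERIV_imp_deriv) (use D(1) DERIV_cong_ev[OF refl e refl] in blast)
    qed
    moreover have "deriv (\<lambda>t. f (flow_line \<Phi> m t)) 0 = frechet_derivative F (at (g 0, 0)) (0, 1)"
      using DERIV_imp_deriv[OF D(2)] by (simp add: F_def g0 c(6)[OF U(2)] flow_line_def)
    moreover have "deriv (\<lambda>t. f (flow_line (flow_comp \<Phi> \<Psi>) m t)) 0 =
      frechet_derivative F (at (g 0, 0)) (vector_derivative g (at 0), 0) +
      frechet_derivative F (at (g 0, 0)) (0, 1)"
    proof -
      have e: "\<forall>\<^sub>F t in nhds 0. f (flow_line (flow_comp \<Phi> \<Psi>) m t) = F (g t, t)"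
        using ev by eventually_elim (auto simp: F_def g_def c(6) flow_line_def flow_comp_def)
      show ?thesis
        by (rule DERIV_imp_deriv) (use D(3) DERIV_cong_ev[OF refl e refl] in blast)
    qed
    ultimately show ?thesis using True by (simp add: velocity_def m0)
  qed
qed

lemma local_flow_comp:
  assumes A: "charted A" and \<Phi>: "local_flow A V \<Phi>" and \<Psi>: "local_flow A W \<Psi>"
  shows "local_flow A (flow_comp_dom V W \<Psi>) (flow_comp \<Phi> \<Psi>)"
proof -
  note f = local_flowD[OF \<Phi>] and g = local_flowD[OF \<Psi>]
  note P = charted_prod_atlas[OF A charted_euclidean]
  have Q: "smooth_map (prod_atlas A euclidean_atlas) (prod_atlas A euclidean_atlas)
      (\<lambda>z. (\<Psi> z, snd z)) W"
    by (intro smooth_map_Pair P A charted_euclidean g smooth_map_snd)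
  have dom: "flow_comp_dom V W \<Psi> = W \<inter> (\<lambda>z. (\<Psi> z, snd z)) -` V"
    by (auto simp: flow_comp_dom_def)
  have comp: "flow_comp \<Phi> \<Psi> = (\<lambda>z. \<Phi> (\<Psi> z, snd z))" by (auto simp: flow_comp_def)
  note R = smooth_map_compose_preimage[OF P P A g(1) f(1) Q f(2), folded dom comp]
  have "flow_comp \<Phi> \<Psi> (m, 0) = m" if "(m, 0) \<in> flow_comp_dom V W \<Psi>" for m
    using that f(3) g(3) by (auto simp: flow_comp_def flow_comp_dom_def)
  moreover have "local_diffeo A (\<lambda>m. flow_comp \<Phi> \<Psi> (m, t)) {m. (m, t) \<in> flow_comp_dom V W \<Psi>}" for t
    using local_diffeo_compose[OF A g(4) f(4), of t t]
    by (simp add: flow_comp_def flow_comp_dom_def)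
  ultimately show ?thesis using R by (simp add: local_flow_def)
qed

lemma parabolic_flow_comp:
  assumes A: "smooth_atlas A" and H: "\<And>m. subspace (H m)"
    and \<Phi>: "parabolic_flow A H V \<Phi>" and \<Psi>: "parabolic_flow A H W \<Psi>"
  shows "parabolic_flow A H (flow_comp_dom V W \<Psi>) (flow_comp \<Phi> \<Psi>)"
proof -
  have f: "local_flow A V \<Phi>" and g: "local_flow A W \<Psi>"
    using \<Phi> \<Psi> by (auto simp: parabolic_flow_def)
  have "velocity A (flow_line (flow_comp \<Phi> \<Psi>) m) \<in> H m" if "(m, 0) \<in> flow_comp_dom V W \<Psi>" for m
  proof -
    have m: "(m, 0) \<in> V" "(m, 0) \<in> W"
      using that local_flowD(3)[OF g] by (auto simp: flow_comp_dom_def)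
    show ?thesis unfolding velocity_flow_comp[OF A f g m]
      using \<Phi> \<Psi> m by (intro subspace_add[OF H]) (auto simp: parabolic_flow_def)
  qed
  then show ?thesis
    using local_flow_comp[OF smooth_atlas_charted[OF A] f g] by (simp add: parabolic_flow_def)
qed

section \<open>Limits of vectors in moving subspaces\<close>

lemma span_image_explicit:
  fixes f :: "'i \<Rightarrow> 'a::real_vector"
  assumes "finite J" "y \<in> span (f ` J)"
  shows "\<exists>a. y = (\<Sum>j\<in>J. a j *\<^sub>R f j)"
proof -
  let ?S = "range (\<lambda>a. \<Sum>j\<in>J. a j *\<^sub>R f j)"
  have "f j \<in> ?S" if "j \<in> J" for j
  proof
    show "f j = (\<Sum>k\<in>J. (if k = j then 1 else 0) *\<^sub>R f k)"
      using that assms(1) by (simp add: if_distrib[of "\<lambda>c. c *\<^sub>R _"] sum.delta' cong: if_cong)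
  qed simp
  moreover have "subspace ?S"
    unfolding subspace_def
  proof (intro conjI ballI allI)
    show "0 \<in> ?S" by (rule image_eqI[of _ _ "\<lambda>_. 0"]) auto
    fix x y c assume "x \<in> ?S" "y \<in> ?S"
    then obtain a b where x: "x = (\<Sum>j\<in>J. a j *\<^sub>R f j)" and y: "y = (\<Sum>j\<in>J. b j *\<^sub>R f j)" by auto
    show "x + y \<in> ?S"
      by (rule image_eqI[of _ _ "\<lambda>j. a j + b j"]) (auto simp: x y scaleR_add_left sum.distrib)
    show "c *\<^sub>R x \<in> ?S"
      by (rule image_eqI[of _ _ "\<lambda>j. c * a j"]) (auto simp: x scaleR_sum_right)
  qed
  ultimately have "span (f ` J) \<subseteq> ?S" by (intro span_minimal) auto
  then show ?thesis using assms(2) by auto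
qed

text \<open>The dimension condition makes the limits \<open>Z j\<close> independent, so there are dual functionals \<open>h k\<close>.
  Applied to $y = \sum_j a_j Y_j$, they recover $a_k$ up to an error that is a small
  multiple of $\sum_j|a_j|$. Hence the coefficients stay bounded, replacing \<open>Y j\<close> by
  \<open>Z j\<close> changes $y$ by a null sequence, and the limit lies in the closed span of the \<open>Z j\<close>.
  Without the dimension condition the conclusion fails: the coefficients could blow up.\<close>

lemma limit_in_span:
  fixes Y :: "'i \<Rightarrow> 's \<Rightarrow> 'a::euclidean_space"
  assumes J: "finite J" and Y: "\<And>j. j \<in> J \<Longrightarrow> (Y j \<longlongrightarrow> Z j) \<F>" and dim: "card J \<le> dim (Z ` J)"
    and y: "(y \<longlongrightarrow> l) \<F>" and mem: "\<forall>\<^sub>F s in \<F>. y s \<in> span ((\<lambda>j. Y j s) ` J)"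
    and nt: "\<F> \<noteq> bot"
  shows "l \<in> span (Z ` J)"
proof -
  have cle: "card (Z ` J) \<le> card J" using J by (rule card_image_le)
  have ind: "independent (Z ` J)"
    by (rule card_le_dim_spanning[of _ "Z ` J"]) (use J dim cle in \<open>auto intro: span_base\<close>)
  have "card (Z ` J) = card J"
    using dim dim_le_card'[of "Z ` J"] J cle by simp
  then have inj: "inj_on Z J" using J eq_card_imp_inj_on by blast
  have "\<exists>h::'a \<Rightarrow> real. linear h \<and> (\<forall>b\<in>Z ` J. h b = (if b = Z k then 1 else 0))" for k
    using linear_independent_extend[OF ind, of "\<lambda>b. if b = Z k then 1 else 0"] by blast
  then obtain h :: "'i \<Rightarrow> 'a \<Rightarrow> real" where lin: "\<And>k. linear (h k)"
    and h: "\<And>k b. b \<in> Z ` J \<Longrightarrow> h k b = (if b = Z k then 1 else 0)" by metis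
  have hZ: "h k (Z j) = (if j = k then 1 else 0)" if "j \<in> J" "k \<in> J" for j k
    using h[of "Z j" k] that inj by (auto simp: inj_on_def)
  have hlim: "((\<lambda>s. h k (w s)) \<longlongrightarrow> h k u) \<F>" if "(w \<longlongrightarrow> u) \<F>" for k w u
    by (rule bounded_linear.tendsto[OF _ that]) (use lin in \<open>simp add: linear_conv_bounded_linear\<close>)
  have "\<forall>s. \<exists>a. y s \<in> span ((\<lambda>j. Y j s) ` J) \<longrightarrow> y s = (\<Sum>j\<in>J. a j *\<^sub>R Y j s)"
    using span_image_explicit[OF J] by blast
  then obtain a where a: "\<And>s. y s \<in> span ((\<lambda>j. Y j s) ` J) \<Longrightarrow> y s = (\<Sum>j\<in>J. a s j *\<^sub>R Y j s)"
    by metis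
  \<comment> \<open>The size of the coefficients is \<open>\<alpha>\<close>. The distance from \<open>Y\<close> to its limit is \<open>\<epsilon>\<close> as seen by the dual functionals and \<open>\<eta>\<close> in norm.\<close>
  define \<alpha> where "\<alpha> s = (\<Sum>j\<in>J. \<bar>a s j\<bar>)" for s
  define \<epsilon> where "\<epsilon> s = (\<Sum>k\<in>J. \<Sum>j\<in>J. \<bar>h k (Y j s - Z j)\<bar>)" for s
  define B where "B s = (\<Sum>k\<in>J. \<bar>h k (y s)\<bar>)" for s
  define \<eta> where "\<eta> s = (\<Sum>j\<in>J. norm (Y j s - Z j))" for s
  have \<alpha>0: "\<alpha> s \<ge> 0" for s by (simp add: \<alpha>_def sum_nonneg)
  have aj: "\<bar>a s j\<bar> \<le> \<alpha> s" if "j \<in> J" for s j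
    unfolding \<alpha>_def using that J by (intro member_le_sum) auto
  have YZ: "((\<lambda>s. Y j s - Z j) \<longlongrightarrow> 0) \<F>" if "j \<in> J" for j
    using Y[OF that] by (simp add: LIM_zero)
  have "(\<epsilon> \<longlongrightarrow> (\<Sum>k\<in>J. \<Sum>j\<in>J. \<bar>h k 0\<bar>)) \<F>"
    unfolding \<epsilon>_def by (intro tendsto_sum tendsto_rabs hlim YZ)
  then have \<epsilon>: "(\<epsilon> \<longlongrightarrow> 0) \<F>" by (simp add: linear_0[OF lin])
  have "(\<eta> \<longlongrightarrow> (\<Sum>j\<in>J. norm (0::'a))) \<F>"
    unfolding \<eta>_def by (intro tendsto_sum tendsto_norm YZ)
  then have \<eta>: "(\<eta> \<longlongrightarrow> 0) \<F>" by simp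
  have B: "(B \<longlongrightarrow> (\<Sum>k\<in>J. \<bar>h k l\<bar>)) \<F>"
    unfolding B_def by (intro tendsto_sum tendsto_rabs hlim y)
  have bound: "norm (y s - (\<Sum>j\<in>J. a s j *\<^sub>R Z j)) \<le> 2 * B s * \<eta> s"
    if s: "y s \<in> span ((\<lambda>j. Y j s) ` J)" "\<epsilon> s < 1/2" for s
  proof -
    have diff: "y s - (\<Sum>j\<in>J. a s j *\<^sub>R Z j) = (\<Sum>j\<in>J. a s j *\<^sub>R (Y j s - Z j))"
      using a[OF s(1)] by (simp add: scaleR_diff_right sum_subtractf)
    have "\<bar>a s k\<bar> \<le> \<bar>h k (y s)\<bar> + \<alpha> s * (\<Sum>j\<in>J. \<bar>h k (Y j s - Z j)\<bar>)" if k: "k \<in> J" for k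
    proof -
      have "h k (y s) - a s k = h k (y s) - (\<Sum>j\<in>J. a s j * h k (Z j))"
        using J k by (simp add: hZ sum.delta if_distrib[of "\<lambda>c. _ * c"] cong: if_cong)
      also have "\<dots> = h k (y s - (\<Sum>j\<in>J. a s j *\<^sub>R Z j))"
        by (simp add: linear_diff[OF lin] linear_sum[OF lin] linear_scale[OF lin])
      also have "\<dots> = (\<Sum>j\<in>J. a s j * h k (Y j s - Z j))"
        unfolding diff by (simp add: linear_sum[OF lin] linear_scale[OF lin])
      also have "\<bar>\<dots>\<bar> \<le> (\<Sum>j\<in>J. \<bar>a s j * h k (Y j s - Z j)\<bar>)" by (rule sum_abs)
      also have "\<dots> \<le> (\<Sum>j\<in>J. \<alpha> s * \<bar>h k (Y j s - Z j)\<bar>)"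
        by (intro sum_mono) (auto simp: abs_mult intro: mult_right_mono aj)
      finally show ?thesis by (simp add: sum_distrib_left)
    qed
    then have "\<alpha> s \<le> (\<Sum>k\<in>J. \<bar>h k (y s)\<bar> + \<alpha> s * (\<Sum>j\<in>J. \<bar>h k (Y j s - Z j)\<bar>))"
      unfolding \<alpha>_def[of s] by (rule sum_mono)
    also have "\<dots> = B s + \<alpha> s * \<epsilon> s"
      by (simp add: sum.distrib B_def \<epsilon>_def sum_distrib_left)
    \<comment> \<open>Here smallness of \<open>\<epsilon>\<close> absorbs the error into the left-hand side.\<close>
    also have "\<alpha> s * \<epsilon> s \<le> \<alpha> s * (1/2)" using \<alpha>0 s(2) by (intro mult_left_mono) auto
    finally have \<alpha>B: "\<alpha> s \<le> 2 * B s" by simp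
    have "norm (y s - (\<Sum>j\<in>J. a s j *\<^sub>R Z j)) \<le> (\<Sum>j\<in>J. norm (a s j *\<^sub>R (Y j s - Z j)))"
      unfolding diff by (rule norm_sum)
    also have "\<dots> \<le> (\<Sum>j\<in>J. \<alpha> s * norm (Y j s - Z j))"
      by (intro sum_mono) (auto intro: mult_right_mono aj)
    also have "\<dots> = \<alpha> s * \<eta> s" by (simp add: \<eta>_def sum_distrib_left)
    also have "\<dots> \<le> 2 * B s * \<eta> s" using \<alpha>B by (intro mult_right_mono) (auto simp: \<eta>_def sum_nonneg)
    finally show ?thesis .
  qed
  have "((\<lambda>s. y s - (\<Sum>j\<in>J. a s j *\<^sub>R Z j)) \<longlongrightarrow> 0) \<F>"
  proof (rule Lim_null_comparison)
    have "\<forall>\<^sub>F s in \<F>. \<epsilon> s < 1/2" using order_tendstoD(2)[OF \<epsilon>, of "1/2"] by simp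
    with mem show "\<forall>\<^sub>F s in \<F>. norm (y s - (\<Sum>j\<in>J. a s j *\<^sub>R Z j)) \<le> 2 * B s * \<eta> s"
      by eventually_elim (rule bound)
    have "((\<lambda>s. 2 * B s * \<eta> s) \<longlongrightarrow> 2 * (\<Sum>k\<in>J. \<bar>h k l\<bar>) * 0) \<F>"
      by (intro tendsto_mult tendsto_const B \<eta>)
    then show "((\<lambda>s. 2 * B s * \<eta> s) \<longlongrightarrow> 0) \<F>" by simp
  qed
  from tendsto_diff[OF y this] have "((\<lambda>s. \<Sum>j\<in>J. a s j *\<^sub>R Z j) \<longlongrightarrow> l) \<F>" by simp
  moreover have "(\<Sum>j\<in>J. a s j *\<^sub>R Z j) \<in> span (Z ` J)" for s
    by (intro span_sum span_scale span_base) auto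
  ultimately show ?thesis
    by (intro Lim_in_closed_set[OF closed_span _ nt]) auto
qed

section \<open>Second-order expansions\<close>

text \<open>Second-order Taylor expansion with Peano remainder. By uniqueness of limits it also reads off the
  second derivative from the quotient, which is how it is used for the composition.\<close>

lemma second_order_limit:
  fixes k :: "real \<Rightarrow> real"
  assumes k: "\<forall>\<^sub>F t in nhds 0. (k has_real_derivative k' t) (at t)"
    and k0: "k 0 = 0" "k' 0 = 0" and k': "(k' has_real_derivative a) (at 0)"
  shows "((\<lambda>t. k t / t\<^sup>2) \<longlongrightarrow> a / 2) (at 0)"
proof (rule lhopital)
  have "(k has_real_derivative k' 0) (at 0)" using k by (rule eventually_nhds_x_imp_x)
  then show "(k \<longlongrightarrow> 0) (at 0)" using DERIV_isCont k0(1) by (metis isCont_def)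
  show "((\<lambda>t::real. t\<^sup>2) \<longlongrightarrow> 0) (at 0)" by (auto intro!: tendsto_eq_intros)
  show "\<forall>\<^sub>F t in at (0::real). t\<^sup>2 \<noteq> 0" by (simp add: eventually_at_filter)
  show "\<forall>\<^sub>F t in at (0::real). 2 * t \<noteq> 0" by (simp add: eventually_at_filter)
  show "\<forall>\<^sub>F t in at 0. (k has_real_derivative k' t) (at t)"
    using k by (simp add: eventually_at_filter) (auto elim: eventually_mono)
  show "\<forall>\<^sub>F t::real in at 0. ((\<lambda>t. t\<^sup>2) has_real_derivative 2 * t) (at t)"
    by (auto intro!: always_eventually derivative_eq_intros)
  have "((\<lambda>t. k' t / t) \<longlongrightarrow> a) (at 0)"
    using k' k0 by (simp add: has_field_derivative_iff)
  then have "((\<lambda>t. k' t / t / 2) \<longlongrightarrow> a / 2) (at 0)" by (intro tendsto_divide) auto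
  then show "((\<lambda>t. k' t / (2 * t)) \<longlongrightarrow> a / 2) (at 0)" by (simp add: mult.commute)
qed

lemma difference_quotient_limit:
  fixes g :: "real \<Rightarrow> 'a::real_normed_vector"
  assumes "(g has_vector_derivative v) (at 0)"
  shows "((\<lambda>t. (1 / t) *\<^sub>R (g t - g 0)) \<longlongrightarrow> v) (at 0)"
proof (rule LIM_zero_cancel, rule tendsto_norm_zero_cancel)
  have "((\<lambda>t. norm (g t - g 0 - t *\<^sub>R v) / norm t) \<longlongrightarrow> 0) (at 0)"
    using assms by (simp add: has_vector_derivative_def has_derivative_at)
  moreover have "\<forall>\<^sub>F t in at (0::real). norm (g t - g 0 - t *\<^sub>R v) / norm t
      = norm ((1 / t) *\<^sub>R (g t - g 0) - v)"
  proof -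
    have "\<forall>\<^sub>F t in at (0::real). t \<noteq> 0" by (simp add: eventually_at_filter)
    then show ?thesis
    proof eventually_elim
      case (elim t)
      then have "(1 / t) *\<^sub>R (g t - g 0) - v = (1 / t) *\<^sub>R (g t - g 0 - t *\<^sub>R v)"
        by (simp add: scaleR_diff_right)
      then show ?case by (simp add: divide_inverse mult.commute)
    qed
  qed
  ultimately show "((\<lambda>t. norm ((1 / t) *\<^sub>R (g t - g 0) - v)) \<longlongrightarrow> 0) (at 0)"
    by (rule Lim_transform_eventually)
qed

text \<open>The curve $(g(t),\theta(t))$ need not be differentiable, since \<open>\<theta>\<close> will be an intermediate
  point of the mean value theorem. It stays within a constant multiple of $|t|$ of $(x_0,0)$, and this is
  enough for the remainder of \<open>P\<close> to be $o(t)$.\<close>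

lemma first_order_expansion:
  fixes P :: "'a::real_normed_vector \<times> real \<Rightarrow> real"
  assumes P: "(P has_derivative L) (at (x0, 0))"
    and g: "(g has_vector_derivative v) (at 0)" "g 0 = x0"
    and \<theta>: "\<forall>\<^sub>F t in at 0. \<bar>\<theta> t\<bar> \<le> \<bar>t\<bar>"
  shows "((\<lambda>t. (P (g t, \<theta> t) - P (x0, 0) - t * L (v, 0) - \<theta> t * L (0, 1)) / t) \<longlongrightarrow> 0) (at 0)"
proof -
  have bl: "bounded_linear L" using P by (rule has_derivative_bounded_linear)
  then have lin: "linear L" by (rule bounded_linear.linear)
  define w where "w t = (1 / t) *\<^sub>R (g t - g 0) - v" for t :: real
  have gw: "g t - x0 = t *\<^sub>R (w t + v)" if "t \<noteq> 0" for t
    using that g(2) by (simp add: w_def)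
  have w: "(w \<longlongrightarrow> 0) (at 0)"
    unfolding w_def by (rule LIM_zero[OF difference_quotient_limit[OF g(1)]])
  have "((\<lambda>t. L (w t, 0)) \<longlongrightarrow> L (0, 0)) (at 0)"
    by (intro bounded_linear.tendsto[OF bl] tendsto_Pair w tendsto_const)
  then have 1: "((\<lambda>t. L (w t, 0)) \<longlongrightarrow> 0) (at 0)" using linear_0[OF lin] by (simp add: zero_prod_def)
  define C where "C = norm v + 2"
  have C: "C > 0" by (simp add: C_def add_nonneg_pos)
  have near: "\<forall>\<^sub>F t in at 0. norm ((g t, \<theta> t) - (x0, 0)) \<le> C * \<bar>t\<bar>"
  proof -
    have "\<forall>\<^sub>F t in at 0. norm (w t) < 1" using tendstoD[OF w, of 1] by simp
    moreover have "\<forall>\<^sub>F t in at (0::real). t \<noteq> 0" by (simp add: eventually_at_filter)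
    ultimately show ?thesis using \<theta>
    proof eventually_elim
      case (elim t)
      have "norm ((g t, \<theta> t) - (x0, 0)) \<le> norm (g t - x0) + norm (\<theta> t)"
        using norm_Pair_le[of "g t - x0" "\<theta> t"] by simp
      also have "\<dots> \<le> \<bar>t\<bar> * (1 + norm v) + \<bar>t\<bar>"
        using elim norm_triangle_ineq[of "w t" v]
        by (intro add_mono) (auto simp: gw intro!: mult_left_mono)
      finally show ?case by (simp add: C_def algebra_simps)
    qed
  qed
  have 2: "((\<lambda>t. (P (g t, \<theta> t) - P (x0, 0) - L ((g t, \<theta> t) - (x0, 0))) / t) \<longlongrightarrow> 0) (at 0)"
  proof (rule tendstoI)
    fix e :: real assume e: "e > 0"
    then have "e / (2 * C) > 0" using C by simp
    then obtain d where d: "d > 0" and dP: "\<And>z. norm (z - (x0, 0)) < d \<Longrightarrow>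
        norm (P z - P (x0, 0) - L (z - (x0, 0))) \<le> e / (2 * C) * norm (z - (x0, 0))"
      using P unfolding has_derivative_at_alt by metis
    have "((\<lambda>t. C * \<bar>t\<bar>) \<longlongrightarrow> 0) (at (0::real))" by (auto intro!: tendsto_eq_intros)
    then have "\<forall>\<^sub>F t in at (0::real). C * \<bar>t\<bar> < d" using order_tendstoD(2) d by blast
    moreover have "\<forall>\<^sub>F t in at (0::real). t \<noteq> 0" by (simp add: eventually_at_filter)
    ultimately show "\<forall>\<^sub>F t in at 0.
        dist ((P (g t, \<theta> t) - P (x0, 0) - L ((g t, \<theta> t) - (x0, 0))) / t) 0 < e"
      using near
    proof eventually_elim
      case (elim t)
      have "norm (P (g t, \<theta> t) - P (x0, 0) - L ((g t, \<theta> t) - (x0, 0)))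
          \<le> e / (2 * C) * norm ((g t, \<theta> t) - (x0, 0))" using elim by (intro dP) simp
      also have "\<dots> \<le> e / (2 * C) * (C * \<bar>t\<bar>)" using e C elim by (intro mult_left_mono) auto
      also have "\<dots> = e / 2 * \<bar>t\<bar>" using C by simp
      also have "\<dots> < e * \<bar>t\<bar>" using e elim by simp
      finally show ?case using elim by (simp add: field_simps)
    qed
  qed
  have "\<forall>\<^sub>F t in at 0. (P (g t, \<theta> t) - P (x0, 0) - L ((g t, \<theta> t) - (x0, 0))) / t + L (w t, 0)
      = (P (g t, \<theta> t) - P (x0, 0) - t * L (v, 0) - \<theta> t * L (0, 1)) / t"
  proof -
    have "\<forall>\<^sub>F t in at (0::real). t \<noteq> 0" by (simp add: eventually_at_filter)
    then show ?thesis
    proof eventually_elim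
      case (elim t)
      have "(g t, \<theta> t) - (x0, 0) = t *\<^sub>R (w t, 0) + t *\<^sub>R (v, 0) + \<theta> t *\<^sub>R (0, 1)"
        using gw[OF elim] by (simp add: scaleR_add_right)
      then have "L ((g t, \<theta> t) - (x0, 0)) = t * L (w t, 0) + t * L (v, 0) + \<theta> t * L (0, 1)"
        by (simp only: linear_add[OF lin] linear_scale[OF lin] real_scaleR_def)
      then show ?case using elim by (simp add: field_simps)
    qed
  qed
  with tendsto_add[OF 2 1] show ?thesis by (simp add: tendsto_cong)
qed

text \<open>The functions \<open>P\<close> and \<open>P'\<close> are the time derivatives of \<open>F\<close> and \<open>F'\<close>. The mean value theorem is applied to the
  difference of the two functions at once, so that both time derivatives are evaluated at the
  same intermediate time; then the terms that contain this time cancel.\<close>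

lemma diagonal_second_order:
  fixes F F' P P' :: "'a::real_normed_vector \<times> real \<Rightarrow> real"
  assumes N: "open N" "(x0, 0) \<in> N"
    and F: "\<And>x t. (x, t) \<in> N \<Longrightarrow> ((\<lambda>s. F (x, s)) has_real_derivative P (x, t)) (at t)"
    and F': "\<And>x t. (x, t) \<in> N \<Longrightarrow> ((\<lambda>s. F' (x, s)) has_real_derivative P' (x, t)) (at t)"
    and P: "(P has_derivative L) (at (x0, 0))" and P': "(P' has_derivative L') (at (x0, 0))"
    and eq: "P (x0, 0) = P' (x0, 0)" "L (v, 0) = L' (v, 0)" "L (0, 1) = L' (0, 1)"
    and g: "(g has_vector_derivative v) (at 0)" "g 0 = x0"
    and g': "(g' has_vector_derivative v) (at 0)" "g' 0 = x0"
  shows "((\<lambda>t. (F (g t, t) - F' (g' t, t) - (F (g t, 0) - F' (g' t, 0))) / t\<^sup>2) \<longlongrightarrow> 0) (at 0)"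
proof -
  define K where "K t s = F (g t, s) - F' (g' t, s)" for t s
  define R where "R t s = P (g t, s) - P' (g' t, s)" for t s
  obtain r where r: "r > 0" "ball x0 r \<times> ball 0 r \<subseteq> N"
  proof -
    obtain X T where XT: "open X" "open T" "(x0, 0) \<in> X \<times> T" "X \<times> T \<subseteq> N"
      using open_prod_elim[OF N] by metis
    then obtain a b where "a > 0" "ball x0 a \<subseteq> X" "b > 0" "ball 0 b \<subseteq> T"
      by (metis mem_Sigma_iff openE)
    then show ?thesis using XT(4) by (intro that[of "min a b"]) (auto simp: subset_eq)
  qed
  have near: "\<forall>\<^sub>F t in at 0. \<gamma> t \<in> ball x0 r" if "(\<gamma> has_vector_derivative v) (at 0)" "\<gamma> 0 = x0" for \<gamma>
  proof -
    have "(\<gamma> \<longlongrightarrow> x0) (at 0)"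
      using has_vector_derivative_continuous[OF that(1)] that(2) by (simp add: continuous_at)
    then show ?thesis using r(1) by (intro topological_tendstoD) auto
  qed
  have tr: "\<forall>\<^sub>F t in at (0::real). \<bar>t\<bar> < r"
    using r(1) eventually_at[of "\<lambda>t. \<bar>t\<bar> < r" "0::real" UNIV] by (auto simp: dist_real_def)
  \<comment> \<open>Mean value theorem in the time variable, on $[0,t]$ or $[t,0]$.\<close>
  have "\<forall>\<^sub>F t in at 0. \<exists>s. \<bar>s\<bar> \<le> \<bar>t\<bar> \<and> K t t - K t 0 = t * R t s"
    using near[OF g] near[OF g'] tr
  proof eventually_elim
    case (elim t)
    have D: "(K t has_real_derivative R t s) (at s)" if "\<bar>s\<bar> \<le> \<bar>t\<bar>" for s
    proof -
      have "(g t, s) \<in> N" "(g' t, s) \<in> N" using r(2) elim that by (auto simp: subset_eq dist_real_def)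
      then show ?thesis unfolding K_def R_def by (intro DERIV_diff F F')
    qed
    consider "t = 0" | "0 < t" | "t < 0" by linarith
    then show ?case
    proof cases
      case 2
      then obtain s where "0 < s" "s < t" "K t t - K t 0 = (t - 0) * R t s"
        using MVT2[of 0 t "K t" "R t"] D by auto
      then show ?thesis by (intro exI[of _ s]) auto
    next
      case 3
      then obtain s where "t < s" "s < 0" "K t 0 - K t t = (0 - t) * R t s"
        using MVT2[of t 0 "K t" "R t"] D by auto
      then show ?thesis by (intro exI[of _ s]) auto
    qed auto
  qed
  then obtain \<theta> where \<theta>: "\<forall>\<^sub>F t in at 0. \<bar>\<theta> t\<bar> \<le> \<bar>t\<bar> \<and> K t t - K t 0 = t * R t (\<theta> t)"
    unfolding eventually_ex by blast
  then have \<theta>1: "\<forall>\<^sub>F t in at 0. \<bar>\<theta> t\<bar> \<le> \<bar>t\<bar>" by eventually_elim simp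
  have "\<forall>\<^sub>F t in at (0::real). t \<noteq> 0" by (simp add: eventually_at_filter)
  with \<theta> have "\<forall>\<^sub>F t in at 0.
      (P (g t, \<theta> t) - P (x0, 0) - t * L (v, 0) - \<theta> t * L (0, 1)) / t -
      (P' (g' t, \<theta> t) - P' (x0, 0) - t * L' (v, 0) - \<theta> t * L' (0, 1)) / t = (K t t - K t 0) / t\<^sup>2"
    by eventually_elim
      (simp add: eq R_def power2_eq_square diff_divide_distrib[symmetric])
  with tendsto_diff[OF first_order_expansion[OF P g \<theta>1] first_order_expansion[OF P' g' \<theta>1]]
  show ?thesis by (simp add: tendsto_cong K_def)
qed

section \<open>Distributions in coordinates\<close>

text \<open>A velocity is a derivation; its values on the coordinate functions are the components of the
  coordinate velocity. The map is defined on all functionals, where it is linear.\<close>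

definition tangent_coordinates :: "('m \<Rightarrow> (real, 'n::finite) vec) \<Rightarrow> 'm tangent \<Rightarrow> (real, 'n) vec" where
  "tangent_coordinates \<phi> \<xi> = (\<chi> i. \<xi> (\<lambda>x. \<phi> x $ i))"

lemma linear_tangent_coordinates: "linear (tangent_coordinates \<phi>)"
  by (rule linearI) (simp_all add: tangent_coordinates_def vec_eq_iff plus_fun_def scaleR_fun_def)

lemma smooth_map_chart_component:
  fixes \<phi> :: "'m::topological_space \<Rightarrow> (real, 'n::finite) vec"
  assumes A: "charted A" and \<phi>: "coordinate_chart A (U, \<phi>)"
  shows "smooth_map A euclidean_atlas (\<lambda>x. \<phi> x $ i) U"
proof -
  have "open U" using \<phi> by (auto simp: coordinate_chart_def dest: topological_chartD(1))
  then show ?thesis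
    by (rule smooth_map_compose[OF A charted_euclidean charted_euclidean _ open_UNIV _
        smooth_map_chart[OF \<phi>]])
      (auto intro: smooth_on_bounded_linear bounded_linear_vec_nth)
qed

lemma velocity_coordinates:
  assumes A: "charted A" and \<phi>: "coordinate_chart A (U, \<phi>)" and c: "c 0 \<in> U"
    and w: "((\<lambda>t. \<phi> (c t)) has_vector_derivative w) (at 0)"
  shows "tangent_coordinates \<phi> (velocity A c) = w"
proof -
  have "open U" using \<phi> by (auto simp: coordinate_chart_def dest: topological_chartD(1))
  then have "smooth_near A (c 0) (\<lambda>x. \<phi> x $ i)" for i
    using smooth_map_chart_component[OF A \<phi>] c unfolding smooth_near_def by blast
  moreover have "deriv (\<lambda>t. \<phi> (c t) $ i) 0 = w $ i" for i
    using bounded_linear.has_vector_derivative[OF bounded_linear_vec_nth w, of i]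
    by (intro DERIV_imp_deriv) (simp add: has_real_derivative_iff_has_vector_derivative)
  ultimately show ?thesis by (simp add: tangent_coordinates_def vec_eq_iff velocity_def)
qed

lemma has_vector_derivative_transform_eventually:
  assumes "\<forall>\<^sub>F t in nhds a. f t = g t" "(g has_vector_derivative D) (at a)"
  shows "(f has_vector_derivative D) (at a)"
proof -
  have "f a = g a" using assms(1) by (rule eventually_nhds_x_imp_x)
  moreover have "\<forall>\<^sub>F t in nhds a. t \<in> UNIV \<longrightarrow> f t = g t" using assms(1) by simp
  ultimately show ?thesis using has_vector_derivative_cong_ev assms(2) by blast
qed

lemma coordinate_vector_coordinates:
  assumes A: "charted A" and \<phi>: "coordinate_chart A (U, \<phi>)" and m: "m \<in> U"
  shows "tangent_coordinates \<phi> (coordinate_vector A (U, \<phi>) m i) = axis i 1"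
proof -
  have "topological_chart (U, \<phi>)" using \<phi> by (simp add: coordinate_chart_def)
  note c = topological_chartD[OF this]
  have "open ((\<lambda>t. \<phi> m + t *\<^sub>R axis i 1) -` \<phi> ` U)" by (intro open_vimage c(2) continuous_intros)
  then have "\<forall>\<^sub>F t in nhds (0::real). t \<in> (\<lambda>t. \<phi> m + t *\<^sub>R axis i 1) -` \<phi> ` U"
    using m by (intro eventually_nhds_in_open) auto
  then have ev: "\<forall>\<^sub>F t in nhds (0::real). \<phi> (inv_into U \<phi> (\<phi> m + t *\<^sub>R axis i 1)) = \<phi> m + t *\<^sub>R axis i 1"
    by eventually_elim (rule f_inv_into_f, simp)
  have "((\<lambda>t. \<phi> m + t *\<^sub>R axis i 1) has_vector_derivative axis i 1) (at (0::real))"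
    by (auto intro!: derivative_eq_intros)
  then have "((\<lambda>t. \<phi> (inv_into U \<phi> (\<phi> m + t *\<^sub>R axis i 1))) has_vector_derivative axis i 1) (at (0::real))"
    by (rule has_vector_derivative_transform_eventually[OF ev])
  then show ?thesis unfolding coordinate_vector_def case_prod_conv
    by (rule velocity_coordinates[OF A \<phi>, rotated]) (simp add: c(6) m)
qed

text \<open>The number of smaller elements is the position in the linear order, a bijection onto an initial segment.\<close>

lemma card_first_indices:
  assumes "p \<le> CARD('n::{finite,linorder})"
  shows "card (first_indices p :: 'n set) = p"
proof -
  define r where "r i = card {j. j < i}" for i :: 'n
  have mono: "r i < r k" if "i < k" for i k
    unfolding r_def using that by (intro psubset_card_mono) auto
  then have inj: "inj r" by (metis injI linorder_less_linear less_irrefl)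
  have "r i < CARD('n)" for i
    unfolding r_def by (intro psubset_card_mono) auto
  then have "range r = {..<CARD('n)}"
    using inj by (intro card_subset_eq) (auto simp: card_image)
  then have "r ` {i. r i < p} = {..<CARD('n)} \<inter> {..<p}" by auto
  then have "r ` {i. r i < p} = {..<p}" using assms by auto
  then have "card (r ` {i. r i < p}) = p" by simp
  moreover have "card (r ` {i. r i < p}) = card {i. r i < p}"
    using inj by (intro card_image) (auto intro: inj_on_subset)
  ultimately show ?thesis by (simp add: first_indices_def r_def)
qed

lemma H_chart_coordinates:
  assumes A: "charted A" and U: "H_chart A p H m (U, \<phi>)"
  shows "tangent_coordinates \<phi> ` H m = span ((\<lambda>i. axis i 1) ` first_indices p)"
proof -
  have ch: "coordinate_chart A (U, \<phi>)" and m: "m \<in> U"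
    and H: "H m = span (coordinate_vector A (U, \<phi>) m ` first_indices p)"
    using U by (auto simp: H_chart_def)
  show ?thesis
    unfolding H linear_span_image[OF linear_tangent_coordinates, symmetric] image_image
    by (simp add: coordinate_vector_coordinates[OF A ch m])
qed

lemma axis_span_component:
  fixes y :: "(real, 'n::finite) vec"
  assumes "y \<in> span ((\<lambda>i. axis i 1) ` I)" "i \<notin> I"
  shows "y $ i = 0"
proof -
  have "subspace {y :: (real, 'n) vec. y $ i = 0}" by (auto simp: subspace_def)
  then have "span ((\<lambda>i. axis i 1) ` I) \<subseteq> {y :: (real, 'n) vec. y $ i = 0}"
    using assms(2) by (intro span_minimal) (auto simp: axis_def)
  then show ?thesis using assms(1) by auto
qed

lemma dim_axis_span:
  "dim ((\<lambda>i. axis i 1 :: (real, 'n::finite) vec) ` I) = card I"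
proof -
  have "independent ((\<lambda>i. axis i 1 :: (real, 'n) vec) ` I)"
    by (rule independent_mono[OF independent_Basis]) (auto simp: axis_in_Basis_iff)
  moreover have "inj_on (\<lambda>i. axis i 1 :: (real, 'n) vec) I"
    by (auto simp: inj_on_def axis_eq_axis)
  ultimately show ?thesis by (simp add: dim_eq_card_independent card_image)
qed

text \<open>The coordinates of a local frame are continuous, because a smooth vector field sends the coordinate
  functions to smooth functions. At \<open>m\<close> the \<open>p\<close> frame vectors span the coordinate subspace
  $\mathbb{R}^p\times\{0\}$, which has dimension \<open>p\<close>; so they are independent there and
  \<open>limit_in_span\<close> applies.\<close>

lemma limit_of_H_vectors:
  fixes A :: "('m::t2_space, (real, 'n::{finite,linorder}) vec) chart set"
  assumes A: "charted A" and H: "distribution A p H" and p: "p \<le> CARD('n)"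
    and U: "H_chart A p H m (U, \<phi>)" and nt: "\<F> \<noteq> bot"
    and x: "(x \<longlongrightarrow> m) \<F>" and \<xi>: "\<forall>\<^sub>F s in \<F>. \<xi> s \<in> H (x s)"
    and y: "((\<lambda>s. tangent_coordinates \<phi> (\<xi> s)) \<longlongrightarrow> y) \<F>" and i: "i \<notin> first_indices p"
  shows "y $ i = 0"
proof -
  let ?c = "tangent_coordinates \<phi>"
  have ch: "coordinate_chart A (U, \<phi>)" and mU: "m \<in> U" using U by (auto simp: H_chart_def)
  then have oU: "open U" by (auto simp: coordinate_chart_def dest: topological_chartD(1))
  obtain G X where G: "open G" "m \<in> G" and X: "\<forall>j<p. smooth_vector_field A (X j) G"
    and HX: "\<forall>x\<in>G. H x = span {X j x |j. j < p}"
    using conjunct2[OF H[unfolded distribution_def]] by (elim allE[of _ m] exE conjE) (rule that)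
  have span: "?c ` H x = span ((\<lambda>j. ?c (X j x)) ` {..<p})" if "x \<in> G" for x
  proof -
    have "{X j x |j. j < p} = (\<lambda>j. X j x) ` {..<p}" by auto
    then show ?thesis using HX that
      by (simp add: linear_span_image[OF linear_tangent_coordinates, symmetric] image_image)
  qed
  have lim: "((\<lambda>s. ?c (X j (x s))) \<longlongrightarrow> ?c (X j m)) \<F>" if "j \<in> {..<p}" for j
  proof (rule vec_tendstoI)
    fix k
    have "smooth_map A euclidean_atlas (\<lambda>x. X j x (\<lambda>x. \<phi> x $ k)) (G \<inter> U)"
    proof -
      have "smooth_map A euclidean_atlas (\<lambda>x. \<phi> x $ k) (G \<inter> U)"
        by (rule smooth_map_subset[OF smooth_map_chart_component[OF A ch, of k]]) simp
      moreover have "open (G \<inter> U)" using G(1) oU by blast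
      moreover have "smooth_vector_field A (X j) G" using X that by simp
      ultimately show ?thesis unfolding smooth_vector_field_def by simp
    qed
    then have "continuous_on (G \<inter> U) (\<lambda>x. X j x (\<lambda>x. \<phi> x $ k))" by (simp add: smooth_map_def)
    then have "isCont (\<lambda>x. X j x (\<lambda>x. \<phi> x $ k)) m"
      using continuous_on_eq_continuous_at[of "G \<inter> U"] oU G mU by auto
    then show "((\<lambda>s. ?c (X j (x s)) $ k) \<longlongrightarrow> ?c (X j m) $ k) \<F>"
      unfolding tangent_coordinates_def vec_lambda_beta by (rule isCont_tendsto_compose) (rule x)
  qed
  have Hm: "span ((\<lambda>j. ?c (X j m)) ` {..<p}) = span ((\<lambda>i. axis i 1) ` first_indices p)"
    using span[OF G(2)] H_chart_coordinates[OF A U] by simp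
  then have "dim ((\<lambda>j. ?c (X j m)) ` {..<p}) = p"
    using dim_span[of "(\<lambda>j. ?c (X j m)) ` {..<p}"] dim_span[of "(\<lambda>i. axis i (1::real)) ` (first_indices p :: 'n set)"]
    by (simp add: dim_axis_span card_first_indices[OF p])
  then have dim: "card {..<p} \<le> dim ((\<lambda>j. ?c (X j m)) ` {..<p})" by simp
  have mem: "\<forall>\<^sub>F s in \<F>. ?c (\<xi> s) \<in> span ((\<lambda>j. ?c (X j (x s))) ` {..<p})"
    using \<xi> topological_tendstoD[OF x G] by eventually_elim (use span in blast)
  have "y \<in> span ((\<lambda>j. ?c (X j m)) ` {..<p})"
    by (rule limit_in_span[OF _ lim dim y mem nt]) auto
  then show ?thesis unfolding Hm using i by (rule axis_span_component)
qed

section \<open>Flows in coordinates\<close>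

lemma smooth_on_curve_derivative:
  fixes x :: "real \<Rightarrow> 'a::real_normed_vector"
  assumes x: "smooth_on x N" and N: "open N" "t \<in> N"
  shows "(x has_vector_derivative vector_derivative x (at t)) (at t)"
    "((\<lambda>t. vector_derivative x (at t)) has_vector_derivative
      vector_derivative (\<lambda>t. vector_derivative x (at t)) (at t)) (at t)"
proof -
  have 1: "(x has_vector_derivative vector_derivative x (at s)) (at s)" if "s \<in> N" for s
    using smooth_on_imp_differentiable[OF x that] by (simp add: vector_derivative_works[symmetric])
  show "(x has_vector_derivative vector_derivative x (at t)) (at t)" using 1 N by blast
  have "frechet_derivative x (at s) 1 = vector_derivative x (at s)" if "s \<in> N" for s
    using frechet_derivative_at[OF 1[OF that, unfolded has_vector_derivative_def]] by (metis scaleR_one)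
  then have "smooth_on (\<lambda>t. vector_derivative x (at t)) N"
    by (rule smooth_on_cong_imp[OF N(1) _ smooth_on_frechet_derivative[OF x]])
  then show "((\<lambda>t. vector_derivative x (at t)) has_vector_derivative
      vector_derivative (\<lambda>t. vector_derivative x (at t)) (at t)) (at t)"
    using smooth_on_imp_differentiable N(2) by (simp add: vector_derivative_works[symmetric])
qed

lemma has_real_derivative_vec_nth:
  fixes z :: "real \<Rightarrow> (real, 'n::finite) vec"
  assumes "(z has_vector_derivative w) (at t)"
  shows "((\<lambda>t. z t $ i) has_real_derivative w $ i) (at t)"
  using bounded_linear.has_vector_derivative[OF bounded_linear_vec_nth assms]
  by (simp add: has_real_derivative_iff_has_vector_derivative)

lemma component_second_order_limit:
  fixes x y :: "real \<Rightarrow> (real, 'n::finite) vec"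
  defines "d \<equiv> \<lambda>(x :: real \<Rightarrow> (real, 'n) vec) t. vector_derivative x (at t)"
  assumes x: "open N" "0 \<in> N" "smooth_on x N" and y: "open N'" "0 \<in> N'" "smooth_on y N'"
    and eq: "x 0 = y 0" "d x 0 = d y 0"
  shows "((\<lambda>t. (x t $ i - y t $ i) / t\<^sup>2) \<longlongrightarrow> (d (d x) 0 - d (d y) 0) $ i / 2) (at 0)"
proof (rule second_order_limit)
  note comp = has_real_derivative_vec_nth
  have ev: "\<forall>\<^sub>F t in nhds 0. t \<in> N \<inter> N'" using x y by (intro eventually_nhds_in_open) auto
  show "\<forall>\<^sub>F t in nhds 0. ((\<lambda>t. x t $ i - y t $ i) has_real_derivative (d x t $ i - d y t $ i)) (at t)"
    using ev unfolding d_def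
    by eventually_elim
      (rule DERIV_diff[OF comp[OF smooth_on_curve_derivative(1)[OF x(3,1)]]
          comp[OF smooth_on_curve_derivative(1)[OF y(3,1)]]], auto)
  show "((\<lambda>t. d x t $ i - d y t $ i) has_real_derivative (d (d x) 0 - d (d y) 0) $ i) (at 0)"
    unfolding d_def vector_minus_component
    by (rule DERIV_diff[OF comp[OF smooth_on_curve_derivative(2)[OF x(3,1,2)]]
          comp[OF smooth_on_curve_derivative(2)[OF y(3,1,2)]]])
qed (use eq in auto)

definition chart_flow :: "'m set \<Rightarrow> ('m \<Rightarrow> 'e) \<Rightarrow> ('m \<times> real \<Rightarrow> 'm) \<Rightarrow> 'e \<times> real \<Rightarrow> 'e" where
  "chart_flow U \<phi> \<Phi> = (\<lambda>z. \<phi> (\<Phi> (inv_into U \<phi> (fst z), snd z)))"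

definition time_derivative :: "('e::real_normed_vector \<times> real \<Rightarrow> 'f::real_normed_vector) \<Rightarrow> 'e \<times> real \<Rightarrow> 'f" where
  "time_derivative F = (\<lambda>z. frechet_derivative F (at z) (0, 1))"

lemma has_vector_derivative_time:
  assumes "F differentiable (at (x, t))"
  shows "((\<lambda>s. F (x, s)) has_vector_derivative time_derivative F (x, t)) (at t)"
proof -
  let ?D = "frechet_derivative F (at (x, t))"
  have D: "(F has_derivative ?D) (at (x, t))"
    using assms by (simp add: frechet_derivative_works)
  have "((\<lambda>s. F (x, s)) has_derivative (\<lambda>h. ?D (0, h))) (at t)"
    by (rule has_derivative_compose[of "\<lambda>s. (x, s)" "\<lambda>h. (0, h)" t UNIV F, OF _ D])
      (rule has_derivative_Pair[OF has_derivative_const has_derivative_ident])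
  moreover have "(\<lambda>h. ?D (0, h)) = (\<lambda>h. h *\<^sub>R ?D (0, 1))"
  proof
    show "?D (0, h) = h *\<^sub>R ?D (0, 1)" for h
      using linear_scale[OF has_derivative_linear[OF D], of h "(0, 1)"] by simp
  qed
  ultimately show ?thesis unfolding has_vector_derivative_def time_derivative_def by (rule has_derivative_eq_rhs)
qed

lemma chart_flow_smooth:
  fixes A :: "('m::topological_space, 'e::euclidean_space) chart set"
  assumes A: "charted A" and \<phi>: "coordinate_chart A (U, \<phi>)" and \<Phi>: "local_flow A V \<Phi>"
    and m: "m \<in> U" "(m, 0) \<in> V"
  shows "\<exists>N. open N \<and> (\<phi> m, 0) \<in> N \<and> smooth_on (chart_flow U \<phi> \<Phi>) N"
proof -
  have "open U" using \<phi> by (auto simp: coordinate_chart_def dest: topological_chartD(1))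
  from flow_in_chart_smooth[OF A \<phi> \<Phi> this smooth_map_chart[OF \<phi>] m m(1)]
  show ?thesis unfolding chart_flow_def .
qed

text \<open>For fixed $x_0=\phi(m)$ the local representative is the flow line of \<open>m\<close>. Its first two derivatives are
  therefore the time derivative \<open>P\<close> at $(x_0,0)$ and the derivative of \<open>P\<close> there in the time direction.\<close>

lemma flow_line_derivatives:
  fixes A :: "('m::topological_space, 'e::euclidean_space) chart set"
  assumes A: "charted A" and \<phi>: "coordinate_chart A (U, \<phi>)" and \<Phi>: "local_flow A V \<Phi>"
    and m: "m \<in> U" "(m, 0) \<in> V"
  defines "P \<equiv> time_derivative (chart_flow U \<phi> \<Phi>)" and "x \<equiv> \<lambda>t. \<phi> (flow_line \<Phi> m t)"
  shows "(x has_vector_derivative P (\<phi> m, 0)) (at 0)"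
    "(P has_derivative frechet_derivative P (at (\<phi> m, 0))) (at (\<phi> m, 0))"
    "vector_derivative x (at 0) = P (\<phi> m, 0)"
    "vector_derivative (\<lambda>t. vector_derivative x (at t)) (at 0)
      = frechet_derivative P (at (\<phi> m, 0)) (0, 1)"
proof -
  let ?F = "chart_flow U \<phi> \<Phi>"
  have "topological_chart (U, \<phi>)" using \<phi> by (simp add: coordinate_chart_def)
  note c = topological_chartD[OF this]
  obtain N where N: "open N" "(\<phi> m, 0) \<in> N" "smooth_on ?F N"
    using chart_flow_smooth[OF A \<phi> \<Phi> m] by blast
  have x: "x = (\<lambda>t. ?F (\<phi> m, t))" using c(6)[OF m(1)] by (simp add: x_def chart_flow_def flow_line_def)
  have dx: "(x has_vector_derivative P (\<phi> m, t)) (at t)" if "(\<phi> m, t) \<in> N" for t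
    unfolding x P_def by (intro has_vector_derivative_time smooth_on_imp_differentiable[OF N(3) that])
  show 1: "(x has_vector_derivative P (\<phi> m, 0)) (at 0)" by (rule dx[OF N(2)])
  then show "vector_derivative x (at 0) = P (\<phi> m, 0)" by (rule vector_derivative_at)
  have "smooth_on P N"
    unfolding P_def time_derivative_def by (rule smooth_on_frechet_derivative[OF N(3)])
  then have dP: "P differentiable (at (\<phi> m, 0))" using N(2) by (rule smooth_on_imp_differentiable)
  then show "(P has_derivative frechet_derivative P (at (\<phi> m, 0))) (at (\<phi> m, 0))"
    by (simp add: frechet_derivative_works)
  have "open ((\<lambda>t. (\<phi> m, t)) -` N)" by (intro open_vimage N(1) continuous_intros)
  then have "\<forall>\<^sub>F t in nhds 0. t \<in> (\<lambda>t. (\<phi> m, t)) -` N" using N(2) by (intro eventually_nhds_in_open) auto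
  then have "\<forall>\<^sub>F t in nhds 0. vector_derivative x (at t) = P (\<phi> m, t)"
    by eventually_elim (auto intro: vector_derivative_at dx)
  moreover have "((\<lambda>t. P (\<phi> m, t)) has_vector_derivative frechet_derivative P (at (\<phi> m, 0)) (0, 1)) (at 0)"
    using has_vector_derivative_time[OF dP] by (simp add: time_derivative_def)
  ultimately have "((\<lambda>t. vector_derivative x (at t)) has_vector_derivative
      frechet_derivative P (at (\<phi> m, 0)) (0, 1)) (at 0)"
    by (rule has_vector_derivative_transform_eventually)
  then show "vector_derivative (\<lambda>t. vector_derivative x (at t)) (at 0)
      = frechet_derivative P (at (\<phi> m, 0)) (0, 1)" by (rule vector_derivative_at)
qed

section \<open>The parabolic arrow of a composition\<close>

lemma velocity_coordinates_smooth_curve: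
  assumes A: "charted A" and \<phi>: "coordinate_chart A (U, \<phi>)" and c: "smooth_curve A c" "c 0 \<in> U"
  shows "\<exists>N. open N \<and> 0 \<in> N \<and> smooth_on (\<lambda>t. \<phi> (c t)) N"
    "tangent_coordinates \<phi> (velocity A c) = vector_derivative (\<lambda>t. \<phi> (c t)) (at 0)"
proof -
  have "open U" using \<phi> by (auto simp: coordinate_chart_def dest: topological_chartD(1))
  from smooth_along_curve[OF A this c(2) smooth_map_chart[OF \<phi>] c(1)]
  show N: "\<exists>N. open N \<and> 0 \<in> N \<and> smooth_on (\<lambda>t. \<phi> (c t)) N" .
  then show "tangent_coordinates \<phi> (velocity A c) = vector_derivative (\<lambda>t. \<phi> (c t)) (at 0)"
    by (intro velocity_coordinates[where c = c, OF A \<phi> c(2)]) (blast intro: smooth_on_curve_derivative(1))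
qed

text \<open>At time $0$, \<open>P\<close> and \<open>P'\<close> are the generating vector fields in coordinates. Their difference is a section
  of \<open>H\<close> that vanishes at \<open>m\<close>, so its derivative in direction \<open>v\<close> is the limit of the
  coordinates of vectors \<open>\<xi> s\<close> of \<open>H\<close> at the points \<open>x s\<close> on the coordinate line in direction \<open>v\<close>.\<close>

lemma generator_difference_derivative:
  fixes A :: "('m::{t2_space,second_countable_topology}, (real, 'n::{finite,linorder}) vec) chart set"
  assumes A: "charted A" and H: "distribution A p H" and p: "p \<le> CARD('n)"
    and U: "H_chart A p H m (U, \<phi>)"
    and \<Phi>: "parabolic_flow A H V \<Phi>" "(m, 0) \<in> V"
    and \<Phi>': "parabolic_flow A H V' \<Phi>'" "(m, 0) \<in> V'"
    and i: "i \<notin> first_indices p"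
  defines "P \<equiv> time_derivative (chart_flow U \<phi> \<Phi>)"
    and "P' \<equiv> time_derivative (chart_flow U \<phi> \<Phi>')"
  assumes eq: "P (\<phi> m, 0) = P' (\<phi> m, 0)"
  shows "frechet_derivative P (at (\<phi> m, 0)) (v, 0) $ i = frechet_derivative P' (at (\<phi> m, 0)) (v, 0) $ i"
proof -
  let ?c = "tangent_coordinates \<phi>"
  have ch: "coordinate_chart A (U, \<phi>)" and m: "m \<in> U" using U by (auto simp: H_chart_def)
  then have "topological_chart (U, \<phi>)" by (simp add: coordinate_chart_def)
  note c = topological_chartD[OF this]
  have fl: "local_flow A V \<Phi>" "local_flow A V' \<Phi>'"
    using \<Phi> \<Phi>' by (auto simp: parabolic_flow_def)
  define x where "x s = inv_into U \<phi> (\<phi> m + s *\<^sub>R v)" for s :: real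
  define \<xi> where "\<xi> s = (1 / s) *\<^sub>R (velocity A (flow_line \<Phi> (x s)) - velocity A (flow_line \<Phi>' (x s)))" for s
  define h where "h s = P (\<phi> m + s *\<^sub>R v, 0) - P' (\<phi> m + s *\<^sub>R v, 0)" for s :: real
  have line: "((\<lambda>s. (\<phi> m + s *\<^sub>R v, 0::real)) has_vector_derivative (v, 0)) (at (0::real))"
    by (intro has_vector_derivative_Pair) (auto intro!: derivative_eq_intros)
  have along: "((\<lambda>s. Q (\<phi> m + s *\<^sub>R v, 0)) has_vector_derivative D (v, 0)) (at 0)"
    if "(Q has_derivative D) (at (\<phi> m, 0))"
    for Q :: "(real, 'n) vec \<times> real \<Rightarrow> (real, 'n) vec" and D
  proof -
    have "((\<lambda>s. Q (\<phi> m + s *\<^sub>R v, 0)) has_derivative (\<lambda>s. D (s *\<^sub>R (v, 0)))) (at 0)"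
      by (rule has_derivative_compose[OF line[unfolded has_vector_derivative_def]])
        (use that in simp)
    moreover have "(\<lambda>s. D (s *\<^sub>R (v, 0))) = (\<lambda>s. s *\<^sub>R D (v, 0))"
      using linear_scale[OF has_derivative_linear[OF that]] by blast
    ultimately show ?thesis unfolding has_vector_derivative_def by (rule has_derivative_eq_rhs)
  qed
  note fd = flow_line_derivatives(2)[OF A ch fl(1) m \<Phi>(2), folded P_def]
    flow_line_derivatives(2)[OF A ch fl(2) m \<Phi>'(2), folded P'_def]
  let ?y = "frechet_derivative P (at (\<phi> m, 0)) (v, 0) - frechet_derivative P' (at (\<phi> m, 0)) (v, 0)"
  have "(h has_vector_derivative ?y) (at 0)"
    unfolding h_def by (intro has_vector_derivative_diff along fd)
  then have hlim: "((\<lambda>s. (1 / s) *\<^sub>R h s) \<longlongrightarrow> ?y) (at 0)"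
    using difference_quotient_limit[of h ?y] eq by (simp add: h_def)
  have "isCont (inv_into U \<phi>) (\<phi> m)"
    using c(2,4) m continuous_on_eq_continuous_at by blast
  moreover have "((\<lambda>s. \<phi> m + s *\<^sub>R v) \<longlongrightarrow> \<phi> m) (at (0::real))" by (auto intro!: tendsto_eq_intros)
  ultimately have "((\<lambda>s. inv_into U \<phi> (\<phi> m + s *\<^sub>R v)) \<longlongrightarrow> inv_into U \<phi> (\<phi> m)) (at 0)"
    by (rule isCont_tendsto_compose)
  then have xlim: "(x \<longlongrightarrow> m) (at 0)" unfolding x_def c(6)[OF m] .
  have "open ((\<lambda>x. (x, 0::real)) -` (V \<inter> V'))"
    by (intro open_vimage open_Int local_flowD(1)[OF fl(1)] local_flowD(1)[OF fl(2)] continuous_intros)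
  then have evV: "\<forall>\<^sub>F s in at 0. x s \<in> (\<lambda>x. (x, 0::real)) -` (V \<inter> V')"
    using \<Phi>(2) \<Phi>'(2) by (intro topological_tendstoD[OF xlim]) auto
  have "((\<lambda>s. \<phi> m + s *\<^sub>R v) \<longlongrightarrow> \<phi> m) (at (0::real))" by (auto intro!: tendsto_eq_intros)
  then have evU: "\<forall>\<^sub>F s in at (0::real). \<phi> m + s *\<^sub>R v \<in> \<phi> ` U"
    using c(2) m by (intro topological_tendstoD) auto
  have mem: "\<forall>\<^sub>F s in at 0. \<xi> s \<in> H (x s)"
    using evV
  proof eventually_elim
    case (elim s)
    have "subspace (H (x s))" using H by (simp add: distribution_def)
    then show ?case unfolding \<xi>_def
      using \<Phi>(1) \<Phi>'(1) elim by (intro subspace_scale subspace_diff) (auto simp: parabolic_flow_def)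
  qed
  have "\<forall>\<^sub>F s in at 0. (1 / s) *\<^sub>R h s = ?c (\<xi> s)"
    using evV evU
  proof eventually_elim
    case (elim s)
    have xs: "x s \<in> U" "\<phi> (x s) = \<phi> m + s *\<^sub>R v"
      using elim(2) by (auto simp: x_def c(6))
    have V: "(x s, 0) \<in> V" "(x s, 0) \<in> V'" using elim(1) by auto
    have "?c (velocity A (flow_line \<Phi> (x s))) = P (\<phi> (x s), 0)"
      unfolding P_def using xs(1) local_flowD(3)[OF fl(1) V(1)]
      by (intro velocity_coordinates[OF A ch] flow_line_derivatives(1)[OF A ch fl(1) xs(1) V(1)])
        (simp add: flow_line_def)
    moreover have "?c (velocity A (flow_line \<Phi>' (x s))) = P' (\<phi> (x s), 0)"
      unfolding P'_def using xs(1) local_flowD(3)[OF fl(2) V(2)]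
      by (intro velocity_coordinates[OF A ch] flow_line_derivatives(1)[OF A ch fl(2) xs(1) V(2)])
        (simp add: flow_line_def)
    ultimately show ?case
      by (simp add: \<xi>_def h_def xs(2) linear_scale[OF linear_tangent_coordinates]
          linear_diff[OF linear_tangent_coordinates])
  qed
  from Lim_transform_eventually[OF hlim this]
  have "?y $ i = 0"
    by (intro limit_of_H_vectors[OF A H p U _ xlim mem _ i]) auto
  then show ?thesis by simp
qed

text \<open>Both flows are replaced at once. The assumptions supply exactly the data that
  \<open>diagonal_second_order\<close> compares: the values of the generating fields at \<open>m\<close>, the second
  time derivatives there, and, through \<open>generator_difference_derivative\<close>, the spatial
  derivatives of the generating fields.\<close>

lemma flow_comp_second_order:
  fixes A :: "('m::{t2_space,second_countable_topology}, (real, 'n::{finite,linorder}) vec) chart set"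
    and c :: "('m \<times> real \<Rightarrow> 'm) \<Rightarrow> real \<Rightarrow> (real, 'n) vec"
  assumes A: "smooth_atlas A" and H: "distribution A p H" and p: "p \<le> CARD('n)"
    and U: "H_chart A p H m (U, \<phi>)"
    and \<Phi>: "parabolic_flow A H V \<Phi>" "(m, 0) \<in> V" and \<Phi>': "parabolic_flow A H V' \<Phi>'" "(m, 0) \<in> V'"
    and \<Psi>: "parabolic_flow A H W \<Psi>" "(m, 0) \<in> W" and \<Psi>': "parabolic_flow A H W' \<Psi>'" "(m, 0) \<in> W'"
  defines "d \<equiv> \<lambda>(x :: real \<Rightarrow> (real, 'n) vec) t. vector_derivative x (at t)"
    and "c \<equiv> \<lambda>\<Theta> t. \<phi> (flow_line \<Theta> m t)"
  assumes eq\<Phi>: "d (c \<Phi>) 0 = d (c \<Phi>') 0" "\<And>i. i \<notin> first_indices p \<Longrightarrow> (d (d (c \<Phi>)) 0 - d (d (c \<Phi>')) 0) $ i = 0"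
    and eq\<Psi>: "d (c \<Psi>) 0 = d (c \<Psi>') 0" "\<And>i. i \<notin> first_indices p \<Longrightarrow> (d (d (c \<Psi>)) 0 - d (d (c \<Psi>')) 0) $ i = 0"
  shows "d (c (flow_comp \<Phi> \<Psi>)) 0 = d (c (flow_comp \<Phi>' \<Psi>')) 0"
    "i \<notin> first_indices p \<Longrightarrow> (d (d (c (flow_comp \<Phi> \<Psi>))) 0 - d (d (c (flow_comp \<Phi>' \<Psi>'))) 0) $ i = 0"
proof -
  note cA = smooth_atlas_charted[OF A]
  have ch: "coordinate_chart A (U, \<phi>)" and m: "m \<in> U" using U by (auto simp: H_chart_def)
  then have "topological_chart (U, \<phi>)" by (simp add: coordinate_chart_def)
  note ct = topological_chartD[OF this]
  have curve: "\<exists>N. open N \<and> 0 \<in> N \<and> smooth_on (c \<Theta>) N"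
    "tangent_coordinates \<phi> (velocity A (flow_line \<Theta> m)) = d (c \<Theta>) 0" "c \<Theta> 0 = \<phi> m"
    if "local_flow A Z \<Theta>" "(m, 0) \<in> Z" for Z \<Theta>
  proof -
    have 0: "flow_line \<Theta> m 0 = m" using local_flowD(3)[OF that] by (simp add: flow_line_def)
    note * = velocity_coordinates_smooth_curve[OF cA ch flow_line_smooth_curve[OF cA that]]
    show "\<exists>N. open N \<and> 0 \<in> N \<and> smooth_on (c \<Theta>) N"
      "tangent_coordinates \<phi> (velocity A (flow_line \<Theta> m)) = d (c \<Theta>) 0" "c \<Theta> 0 = \<phi> m"
      using * 0 m by (simp_all add: c_def d_def)
  qed
  have comp: "d (c (flow_comp \<Phi> \<Psi>)) 0 = d (c \<Phi>) 0 + d (c \<Psi>) 0"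
    "\<exists>N. open N \<and> 0 \<in> N \<and> smooth_on (c (flow_comp \<Phi> \<Psi>)) N" "c (flow_comp \<Phi> \<Psi>) 0 = \<phi> m"
    "\<forall>\<^sub>F t in at 0. chart_flow U \<phi> \<Phi> (c \<Psi> t, 0) = c \<Psi> t
      \<and> chart_flow U \<phi> \<Phi> (c \<Psi> t, t) = c (flow_comp \<Phi> \<Psi>) t"
    if pf: "local_flow A V \<Phi>" "local_flow A W \<Psi>" and V: "(m, 0) \<in> V" and W: "(m, 0) \<in> W" for \<Phi> \<Psi> V W
  proof -
    note fc = local_flow_comp[OF cA pf]
    have dom: "(m, 0) \<in> flow_comp_dom V W \<Psi>"
      using V W local_flowD(3)[OF pf(2) W] by (simp add: flow_comp_dom_def)
    show "d (c (flow_comp \<Phi> \<Psi>)) 0 = d (c \<Phi>) 0 + d (c \<Psi>) 0"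
      unfolding curve(2)[OF fc dom, symmetric] curve(2)[OF pf(1) V, symmetric] curve(2)[OF pf(2) W, symmetric]
        velocity_flow_comp[OF A pf V W]
      by (rule linear_add[OF linear_tangent_coordinates])
    show "\<exists>N. open N \<and> 0 \<in> N \<and> smooth_on (c (flow_comp \<Phi> \<Psi>)) N" "c (flow_comp \<Phi> \<Psi>) 0 = \<phi> m"
      by (rule curve(1,3)[OF fc dom])+
    have "open ((\<lambda>x. (x, 0)) -` V)"
      by (intro open_vimage local_flowD(1)[OF pf(1)] continuous_intros)
    then have "\<forall>\<^sub>F t in nhds 0. \<Psi> (m, t) \<in> U \<inter> (\<lambda>x. (x, 0)) -` V"
      using ct(1) m V by (intro eventually_flow_line_in[OF cA pf(2) W]) auto
    then have "\<forall>\<^sub>F t in at 0. \<Psi> (m, t) \<in> U \<inter> (\<lambda>x. (x, 0)) -` V"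
      by (simp add: eventually_at_filter) (auto elim: eventually_mono)
    then show "\<forall>\<^sub>F t in at 0. chart_flow U \<phi> \<Phi> (c \<Psi> t, 0) = c \<Psi> t
      \<and> chart_flow U \<phi> \<Phi> (c \<Psi> t, t) = c (flow_comp \<Phi> \<Psi>) t"
      by eventually_elim
        (auto simp: chart_flow_def c_def flow_line_def flow_comp_def ct(6) local_flowD(3)[OF pf(1)])
  qed
  have fl: "local_flow A V \<Phi>" "local_flow A V' \<Phi>'" "local_flow A W \<Psi>" "local_flow A W' \<Psi>'"
    using \<Phi> \<Phi>' \<Psi> \<Psi>' by (auto simp: parabolic_flow_def)
  \<comment> \<open>The facts above are stated for an arbitrary pair of flows because they are needed for both compositions.\<close>
  note cp = comp[OF fl(1,3) \<Phi>(2) \<Psi>(2)] and cp' = comp[OF fl(2,4) \<Phi>'(2) \<Psi>'(2)]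
  show d1: "d (c (flow_comp \<Phi> \<Psi>)) 0 = d (c (flow_comp \<Phi>' \<Psi>')) 0"
    unfolding cp(1) cp'(1) eq\<Phi>(1) eq\<Psi>(1) ..
  assume i: "i \<notin> first_indices p"
  let ?F = "chart_flow U \<phi> \<Phi>" and ?F' = "chart_flow U \<phi> \<Phi>'"
  let ?P = "time_derivative ?F" and ?P' = "time_derivative ?F'"
  let ?L = "frechet_derivative ?P (at (\<phi> m, 0))" and ?L' = "frechet_derivative ?P' (at (\<phi> m, 0))"
  note fd = flow_line_derivatives[OF cA ch fl(1) m \<Phi>(2)]
  note fd' = flow_line_derivatives[OF cA ch fl(2) m \<Phi>'(2)]
  obtain N N' where N: "open N" "(\<phi> m, 0) \<in> N" "smooth_on ?F N"
    and N': "open N'" "(\<phi> m, 0) \<in> N'" "smooth_on ?F' N'"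
    using chart_flow_smooth[OF cA ch fl(1) m \<Phi>(2)] chart_flow_smooth[OF cA ch fl(2) m \<Phi>'(2)] by blast
  have gd: "(c \<Psi> has_vector_derivative d (c \<Psi>) 0) (at 0)"
    using curve(1)[OF fl(3) \<Psi>(2)] smooth_on_curve_derivative(1) unfolding d_def by blast
  have "(c \<Psi>' has_vector_derivative d (c \<Psi>') 0) (at 0)"
    using curve(1)[OF fl(4) \<Psi>'(2)] smooth_on_curve_derivative(1) unfolding d_def by blast
  then have gd': "(c \<Psi>' has_vector_derivative d (c \<Psi>) 0) (at 0)" by (simp only: eq\<Psi>(1))
  have P0: "?P (\<phi> m, 0) = ?P' (\<phi> m, 0)" using fd(3) fd'(3) eq\<Phi>(1) by (simp add: c_def d_def)
  have "((\<lambda>t. (?F (c \<Psi> t, t) $ i - ?F' (c \<Psi>' t, t) $ i - (?F (c \<Psi> t, 0) $ i - ?F' (c \<Psi>' t, 0) $ i)) / t\<^sup>2)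
      \<longlongrightarrow> 0) (at 0)"
  proof (rule diagonal_second_order[where N = "N \<inter> N'" and g = "c \<Psi>" and g' = "c \<Psi>'"
        and P = "\<lambda>z. ?P z $ i" and P' = "\<lambda>z. ?P' z $ i" and v = "d (c \<Psi>) 0" and ?x0.0 = "\<phi> m"
        and L = "\<lambda>w. ?L w $ i" and L' = "\<lambda>w. ?L' w $ i"])
    show "((\<lambda>z. ?P z $ i) has_derivative (\<lambda>w. ?L w $ i)) (at (\<phi> m, 0))"
      "((\<lambda>z. ?P' z $ i) has_derivative (\<lambda>w. ?L' w $ i)) (at (\<phi> m, 0))"
      by (intro bounded_linear.has_derivative[OF bounded_linear_vec_nth] fd(2) fd'(2))+
    show "?L (d (c \<Psi>) 0, 0) $ i = ?L' (d (c \<Psi>) 0, 0) $ i"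
      by (rule generator_difference_derivative[OF cA H p U \<Phi> \<Phi>' i P0])
    show "?L (0, 1) $ i = ?L' (0, 1) $ i" using eq\<Phi>(2)[OF i] fd(4) fd'(4) by (simp add: c_def d_def)
    show "((\<lambda>s. ?F (x, s) $ i) has_real_derivative ?P (x, t) $ i) (at t)"
      "((\<lambda>s. ?F' (x, s) $ i) has_real_derivative ?P' (x, t) $ i) (at t)" if "(x, t) \<in> N \<inter> N'" for x t
      using that N(3) N'(3)
      by (auto intro!: has_real_derivative_vec_nth has_vector_derivative_time intro: smooth_on_imp_differentiable)
  qed (use N N' P0 gd gd' curve(3)[OF fl(3) \<Psi>(2)] curve(3)[OF fl(4) \<Psi>'(2)] in auto)
  moreover have "\<forall>\<^sub>F t in at 0.
      (?F (c \<Psi> t, t) $ i - ?F' (c \<Psi>' t, t) $ i - (?F (c \<Psi> t, 0) $ i - ?F' (c \<Psi>' t, 0) $ i)) / t\<^sup>2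
      = (c (flow_comp \<Phi> \<Psi>) t $ i - c (flow_comp \<Phi>' \<Psi>') t $ i) / t\<^sup>2 - (c \<Psi> t $ i - c \<Psi>' t $ i) / t\<^sup>2"
    using cp(4) cp'(4) by eventually_elim (simp add: diff_divide_distrib)
  ultimately have lim: "((\<lambda>t. (c (flow_comp \<Phi> \<Psi>) t $ i - c (flow_comp \<Phi>' \<Psi>') t $ i) / t\<^sup>2
      - (c \<Psi> t $ i - c \<Psi>' t $ i) / t\<^sup>2) \<longlongrightarrow> 0) (at 0)"
    by (rule Lim_transform_eventually)
  have second: "((\<lambda>t. (x t $ i - y t $ i) / t\<^sup>2) \<longlongrightarrow> (d (d x) 0 - d (d y) 0) $ i / 2) (at 0)"
    if "\<exists>N. open N \<and> 0 \<in> N \<and> smooth_on x N" "\<exists>N. open N \<and> 0 \<in> N \<and> smooth_on y N"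
      "x 0 = y 0" "d x 0 = d y 0" for x y
    using that component_second_order_limit[of _ x _ y] unfolding d_def by blast
  have "((\<lambda>t. (c \<Psi> t $ i - c \<Psi>' t $ i) / t\<^sup>2) \<longlongrightarrow> 0) (at 0)"
    using second[OF curve(1)[OF fl(3) \<Psi>(2)] curve(1)[OF fl(4) \<Psi>'(2)] _ eq\<Psi>(1)]
      curve(3)[OF fl(3) \<Psi>(2)] curve(3)[OF fl(4) \<Psi>'(2)] eq\<Psi>(2)[OF i] by simp
  from tendsto_add[OF lim this]
  have "((\<lambda>t. (c (flow_comp \<Phi> \<Psi>) t $ i - c (flow_comp \<Phi>' \<Psi>') t $ i) / t\<^sup>2) \<longlongrightarrow> 0) (at 0)" by simp
  from tendsto_unique[OF _ second[OF cp(2) cp'(2) _ d1] this] cp(3) cp'(3)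
  show "(d (d (c (flow_comp \<Phi> \<Psi>))) 0 - d (d (c (flow_comp \<Phi>' \<Psi>'))) 0) $ i = 0" by simp
qed

lemma parabolic_equiv_sym: "parabolic_equiv A p H c c' \<Longrightarrow> parabolic_equiv A p H c' c"
  unfolding parabolic_equiv_def Let_def by (auto simp: algebra_simps)

lemma parabolic_equiv_trans:
  "parabolic_equiv A p H c c' \<Longrightarrow> parabolic_equiv A p H c' c'' \<Longrightarrow> parabolic_equiv A p H c c''"
  unfolding parabolic_equiv_def Let_def by (auto simp: algebra_simps)

text \<open>An arrow is an equivalence class only for a parabolic curve; other curves are equivalent to nothing
  and all have the empty set as their arrow, hence the assumption.\<close>

lemma parabolic_arrow_eq_iff:
  assumes "parabolic_curve A H c"
  shows "parabolic_arrow A p H c = parabolic_arrow A p H c' \<longleftrightarrow> parabolic_equiv A p H c c'"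
proof
  assume "parabolic_arrow A p H c = parabolic_arrow A p H c'"
  moreover have "parabolic_equiv A p H c c" using assms by (simp add: parabolic_equiv_def)
  ultimately have "parabolic_equiv A p H c' c" by (auto simp: parabolic_arrow_def)
  then show "parabolic_equiv A p H c c'" by (rule parabolic_equiv_sym)
next
  assume "parabolic_equiv A p H c c'"
  then show "parabolic_arrow A p H c = parabolic_arrow A p H c'"
    unfolding parabolic_arrow_def by (blast intro: parabolic_equiv_sym parabolic_equiv_trans)
qed

lemma flow_line_parabolic_curve:
  assumes "charted A" "parabolic_flow A H V \<Phi>" "(m, 0) \<in> V"
  shows "parabolic_curve A H (flow_line \<Phi> m)" "flow_line \<Phi> m 0 = m"
  using assms flow_line_smooth_curve[of A V \<Phi> m] local_flowD(3)[of A V \<Phi> m]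
  by (auto simp: parabolic_curve_def parabolic_flow_def flow_line_def)

lemma flow_comp_parabolic_equiv:
  fixes A :: "('m::{t2_space,second_countable_topology}, (real, 'n::{finite,linorder}) vec) chart set"
  assumes A: "smooth_atlas A" and H: "distribution A p H" and p: "p \<le> CARD('n)"
    and \<Phi>: "parabolic_flow A H V \<Phi>" "(m, 0) \<in> V" and \<Phi>': "parabolic_flow A H V' \<Phi>'" "(m, 0) \<in> V'"
    and \<Psi>: "parabolic_flow A H W \<Psi>" "(m, 0) \<in> W" and \<Psi>': "parabolic_flow A H W' \<Psi>'" "(m, 0) \<in> W'"
    and eq\<Phi>: "parabolic_equiv A p H (flow_line \<Phi> m) (flow_line \<Phi>' m)"
    and eq\<Psi>: "parabolic_equiv A p H (flow_line \<Psi> m) (flow_line \<Psi>' m)"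
  shows "parabolic_equiv A p H (flow_line (flow_comp \<Phi> \<Psi>) m) (flow_line (flow_comp \<Phi>' \<Psi>') m)"
proof -
  note cA = smooth_atlas_charted[OF A]
  have sub: "\<And>m. subspace (H m)" using H by (simp add: distribution_def)
  note lines = flow_line_parabolic_curve[OF cA \<Phi>] flow_line_parabolic_curve[OF cA \<Psi>]
    flow_line_parabolic_curve[OF cA \<Phi>'] flow_line_parabolic_curve[OF cA \<Psi>']
  have dom: "(m, 0) \<in> flow_comp_dom V W \<Psi>" "(m, 0) \<in> flow_comp_dom V' W' \<Psi>'"
    using \<Phi> \<Phi>' \<Psi> \<Psi>' lines by (auto simp: flow_comp_dom_def flow_line_def)
  note comp = flow_line_parabolic_curve[OF cA parabolic_flow_comp[OF A sub \<Phi>(1) \<Psi>(1)] dom(1)]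
    flow_line_parabolic_curve[OF cA parabolic_flow_comp[OF A sub \<Phi>'(1) \<Psi>'(1)] dom(2)]
  let ?d = "\<lambda>(x :: real \<Rightarrow> (real, 'n) vec) t. vector_derivative x (at t)"
  let ?x = "\<lambda>\<phi> \<Theta> t. \<phi> (flow_line \<Theta> m t)"
  have iff: "parabolic_equiv A p H (flow_line \<Theta> m) (flow_line \<Theta>' m) \<longleftrightarrow>
     (\<forall>U \<phi>. H_chart A p H m (U, \<phi>) \<longrightarrow> ?d (?x \<phi> \<Theta>) 0 = ?d (?x \<phi> \<Theta>') 0 \<and>
        (\<forall>i. i \<notin> first_indices p \<longrightarrow> (?d (?d (?x \<phi> \<Theta>)) 0 - ?d (?d (?x \<phi> \<Theta>')) 0) $ i = 0))"
    if "parabolic_curve A H (flow_line \<Theta> m)" "flow_line \<Theta> m 0 = m"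
      "parabolic_curve A H (flow_line \<Theta>' m)" "flow_line \<Theta>' m 0 = m" for \<Theta> \<Theta>'
    unfolding parabolic_equiv_def Let_def using that by simp
  show ?thesis
    unfolding iff[OF comp]
  proof (intro allI impI)
    fix U \<phi> assume U: "H_chart A p H m (U, \<phi>)"
    show "?d (?x \<phi> (flow_comp \<Phi> \<Psi>)) 0 = ?d (?x \<phi> (flow_comp \<Phi>' \<Psi>')) 0 \<and>
        (\<forall>i. i \<notin> first_indices p \<longrightarrow>
          (?d (?d (?x \<phi> (flow_comp \<Phi> \<Psi>))) 0 - ?d (?d (?x \<phi> (flow_comp \<Phi>' \<Psi>'))) 0) $ i = 0)"
      using eq\<Phi>[unfolded iff[OF lines(1,2,5,6)]] eq\<Psi>[unfolded iff[OF lines(3,4,7,8)]] U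
      by (intro conjI allI impI flow_comp_second_order[OF A H p U \<Phi> \<Phi>' \<Psi> \<Psi>']) auto
  qed
qed

theorem proposition11:
  fixes A :: "('m::{t2_space,second_countable_topology}, (real, 'n::{finite,linorder}) vec) chart set"
    and H :: "'m \<Rightarrow> 'm tangent set"
    and p q :: nat
    and V W :: "('m \<times> real) set"
    and \<Phi> \<Psi> :: "'m \<times> real \<Rightarrow> 'm"
  assumes "smooth_atlas A"
    and "CARD('n) = p + q"
    and "distribution A p H"
    and "parabolic_flow A H V \<Phi>"
    and "parabolic_flow A H W \<Psi>"
  shows "parabolic_flow A H (flow_comp_dom V W \<Psi>) (flow_comp \<Phi> \<Psi>) \<and>
    (\<forall>m V' W' \<Phi>' \<Psi>'.
       parabolic_flow A H V' \<Phi>' \<longrightarrow> parabolic_flow A H W' \<Psi>' \<longrightarrow>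
       (m, 0) \<in> V \<inter> W \<longrightarrow> (m, 0) \<in> V' \<inter> W' \<longrightarrow>
       parabolic_arrow A p H (flow_line \<Phi> m) = parabolic_arrow A p H (flow_line \<Phi>' m) \<longrightarrow>
       parabolic_arrow A p H (flow_line \<Psi> m) = parabolic_arrow A p H (flow_line \<Psi>' m) \<longrightarrow>
       parabolic_arrow A p H (flow_line (flow_comp \<Phi> \<Psi>) m) =
       parabolic_arrow A p H (flow_line (flow_comp \<Phi>' \<Psi>') m))"
proof (intro conjI allI impI)
  note A = smooth_atlas_charted[OF assms(1)]
  have sub: "subspace (H m)" for m using assms(3) by (simp add: distribution_def)
  show comp: "parabolic_flow A H (flow_comp_dom V W \<Psi>) (flow_comp \<Phi> \<Psi>)"
    by (rule parabolic_flow_comp[OF assms(1) sub assms(4,5)])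
  fix m V' W' \<Phi>' \<Psi>'
  assume flows': "parabolic_flow A H V' \<Phi>'" "parabolic_flow A H W' \<Psi>'"
    and m: "(m, 0) \<in> V \<inter> W" "(m, 0) \<in> V' \<inter> W'"
    and eq: "parabolic_arrow A p H (flow_line \<Phi> m) = parabolic_arrow A p H (flow_line \<Phi>' m)"
      "parabolic_arrow A p H (flow_line \<Psi> m) = parabolic_arrow A p H (flow_line \<Psi>' m)"
  have m': "(m, 0) \<in> V" "(m, 0) \<in> W" "(m, 0) \<in> V'" "(m, 0) \<in> W'" using m by auto
  note \<Phi> = flow_line_parabolic_curve[OF A assms(4) m'(1)]
    and \<Psi> = flow_line_parabolic_curve[OF A assms(5) m'(2)]
  have "(m, 0) \<in> flow_comp_dom V W \<Psi>"
    using m' \<Psi>(2) by (simp add: flow_comp_dom_def flow_line_def)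
  note c = flow_line_parabolic_curve(1)[OF A comp this]
  have p: "p \<le> CARD('n)" using assms(2) by simp
  show "parabolic_arrow A p H (flow_line (flow_comp \<Phi> \<Psi>) m) =
       parabolic_arrow A p H (flow_line (flow_comp \<Phi>' \<Psi>') m)"
    unfolding parabolic_arrow_eq_iff[OF c]
    by (rule flow_comp_parabolic_equiv[OF assms(1,3) p assms(4) m'(1) flows'(1) m'(3)
          assms(5) m'(2) flows'(2) m'(4)
          eq(1)[unfolded parabolic_arrow_eq_iff[OF \<Phi>(1)]]
          eq(2)[unfolded parabolic_arrow_eq_iff[OF \<Psi>(1)]]])
qed

end
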